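(* There is an open set $H_\beta\subset\mathbb{C}$ containing $\mathbb{C}-M_{\beta,0}$ and every simple centre such that $\mathbf{f}_c$ is hyperbolic for every $c\in H_\beta$, i.e. $$\hat{\mathbb{C}}-J_c=\{z\in\hat{\mathbb{C}}:\ \omega(z,\mathbf{f}_c)\subset J_c^*\cup\{\infty\}\}.$$ Moreover, for every $c\in H_\beta$, backward orbits of any point $z\in\mathbb{C}-P_c$ accumulate on $J_c$, i.e. $\alpha(z,\mathbf{f}_c)=J_c$.
   Context: Fix integers $p>q\ge 1$, $\beta=p/q$. For $c\in\mathbb{C}$, $\mathbf{f}_c(z)=\{w:(w-c)^q=z^p\}$ for $z\in\mathbb{C}$, $\mathbf{f}_c(\infty)=\{\infty\}$. A forward orbit is a sequence with $z_{i+1}\in\mathbf{f}_c(z_i)$; a backward orbit is a sequence with $z_i\in\mathbf{f}_c(z_{i+1})$; a cycle is a periodic forward orbit. A branch of $\mathbf{f}_c$ is a holomorphic $\varphi$ with $(\varphi(z)-c)^q=z^p$ on its domain. A cycle $(z_i)$ of period $n$ in $\mathbb{C}$ is attracting if it contains $0$, or if it does not contain $0$ and its multiplier $\lambda=\prod_{i=0}^{n-1}\varphi_i'(z_i)$ ($\varphi_i$ a branch with $\varphi_i(z_i)=z_{i+1}$) satisfies $|\lambda|<1$; it is repelling if it does not contain $0$ and $|\lambda|>1$. $J_c$ is the closure of the union of all repelling cycles; $J_c^*$ is the closure of the union of all attracting cycles in $\mathbb{C}$. $K_c$ is the set of points of $\mathbb{C}$ having at least one bounded forward orbit, and $M_{\beta,0}=\{c\in\mathbb{C}:0\in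 K_c\}$. A parameter $c$ is a simple centre if $0$ has only one bounded forward orbit under $\mathbf{f}_c$ and this orbit is a cycle. $P_c=\overline{\bigcup_{n>0}\mathbf{f}_c^n(0)}$ is the post-critical set. $\omega(z,\mathbf{f}_c)$ is the set of limits (in $\hat{\mathbb{C}}$) of convergent subsequences of forward orbits starting at $z$; $\alpha(z,\mathbf{f}_c)$ is the set of $\zeta\in\mathbb{C}$ that are limits of subsequences of some backward orbit of $z$. *)

theory Defs
  imports "HOL-Analysis.Analysis"
begin

text \<open>
  The correspondence \<open>(w - c)^q = z^p\<close> on the plane, where \<open>p > q \<ge> 1\<close> (not necessarily coprime),
  and its extension to the Riemann sphere.  The sphere is the one-point compactification of the
  plane: \<open>Some z\<close> is a finite point and \<open>None\<close> is \<open>\<infinity>\<close>.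
\<close>

definition corr :: "nat \<Rightarrow> nat \<Rightarrow> complex \<Rightarrow> complex \<Rightarrow> complex set" where
  "corr p q c z = {w. (w - c) ^ q = z ^ p}"

abbreviation riemann_sphere :: "complex option topology" where
  "riemann_sphere \<equiv> Alexandroff_compactification euclidean"

fun sphere_corr :: "nat \<Rightarrow> nat \<Rightarrow> complex \<Rightarrow> complex option \<Rightarrow> complex option set" where
  "sphere_corr p q c None = {None}"
| "sphere_corr p q c (Some z) = Some ` corr p q c z"

definition forward_orbit :: "('a \<Rightarrow> 'a set) \<Rightarrow> (nat \<Rightarrow> 'a) \<Rightarrow> bool" where
  "forward_orbit f x \<longleftrightarrow> (\<forall>i. x (Suc i) \<in> f (x i))"

definition backward_orbit :: "('a \<Rightarrow> 'a set) \<Rightarrow> (nat \<Rightarrow> 'a) \<Rightarrow> bool" where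
  "backward_orbit f x \<longleftrightarrow> (\<forall>i. x i \<in> f (x (Suc i)))"

text \<open>A cycle is given as an indexed orbit, since the correspondence may leave a point it
  revisits along a different branch.  The period \<open>n\<close> need not be minimal: passing to a multiple
  of it replaces the multiplier by a power.\<close>

definition is_cycle :: "nat \<Rightarrow> nat \<Rightarrow> complex \<Rightarrow> nat \<Rightarrow> (nat \<Rightarrow> complex) \<Rightarrow> bool" where
  "is_cycle p q c n x \<longleftrightarrow> n > 0 \<and> forward_orbit (corr p q c) x \<and> (\<forall>i. x (i + n) = x i)"

definition is_branch :: "nat \<Rightarrow> nat \<Rightarrow> complex \<Rightarrow> complex set \<Rightarrow> (complex \<Rightarrow> complex) \<Rightarrow> bool" where
  "is_branch p q c U \<phi> \<longleftrightarrow> open U \<and> \<phi> holomorphic_on U \<and> (\<forall>z\<in>U. (\<phi> z - c) ^ q = z ^ p)"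

text \<open>Along a cycle avoiding \<open>0\<close> the germ of the branch sending \<open>x i\<close> to \<open>x (Suc i)\<close> exists and
  is unique, so the following relation determines \<open>l\<close>.\<close>

definition is_multiplier ::
    "nat \<Rightarrow> nat \<Rightarrow> complex \<Rightarrow> nat \<Rightarrow> (nat \<Rightarrow> complex) \<Rightarrow> complex \<Rightarrow> bool" where
  "is_multiplier p q c n x l \<longleftrightarrow>
     (\<exists>\<phi> U. (\<forall>i<n. is_branch p q c (U i) (\<phi> i) \<and> x i \<in> U i \<and> \<phi> i (x i) = x (Suc i)) \<and>
            l = (\<Prod>i<n. deriv (\<phi> i) (x i)))"

definition attracting_cycle :: "nat \<Rightarrow> nat \<Rightarrow> complex \<Rightarrow> nat \<Rightarrow> (nat \<Rightarrow> complex) \<Rightarrow> bool" where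
  "attracting_cycle p q c n x \<longleftrightarrow> is_cycle p q c n x \<and>
     (0 \<in> range x \<or> (0 \<notin> range x \<and> (\<exists>l. is_multiplier p q c n x l \<and> norm l < 1)))"

definition repelling_cycle :: "nat \<Rightarrow> nat \<Rightarrow> complex \<Rightarrow> nat \<Rightarrow> (nat \<Rightarrow> complex) \<Rightarrow> bool" where
  "repelling_cycle p q c n x \<longleftrightarrow> is_cycle p q c n x \<and>
     0 \<notin> range x \<and> (\<exists>l. is_multiplier p q c n x l \<and> norm l > 1)"

text \<open>Closures are taken in the plane.  For the two Julia sets this agrees with the closure in the
  sphere, because the cycles of a given correspondence in the plane are uniformly bounded.\<close>

definition julia_set :: "nat \<Rightarrow> nat \<Rightarrow> complex \<Rightarrow> complex set" where
  "julia_set p q c = closure (\<Union>{range x | x n. repelling_cycle p q c n x})"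

definition dual_julia_set :: "nat \<Rightarrow> nat \<Rightarrow> complex \<Rightarrow> complex set" where
  "dual_julia_set p q c = closure (\<Union>{range x | x n. attracting_cycle p q c n x})"

definition filled_julia_set :: "nat \<Rightarrow> nat \<Rightarrow> complex \<Rightarrow> complex set" where
  "filled_julia_set p q c =
     {z. \<exists>x. forward_orbit (corr p q c) x \<and> x 0 = z \<and> bounded (range x)}"

definition mandelbrot_set :: "nat \<Rightarrow> nat \<Rightarrow> complex set" where
  "mandelbrot_set p q = {c. 0 \<in> filled_julia_set p q c}"

definition simple_centre :: "nat \<Rightarrow> nat \<Rightarrow> complex \<Rightarrow> bool" where
  "simple_centre p q c \<longleftrightarrow>
     (\<exists>!x. forward_orbit (corr p q c) x \<and> x 0 = 0 \<and> bounded (range x)) \<and>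
     (\<forall>x. forward_orbit (corr p q c) x \<and> x 0 = 0 \<and> bounded (range x) \<longrightarrow>
          (\<exists>n. is_cycle p q c n x))"

definition image_iter :: "('a \<Rightarrow> 'a set) \<Rightarrow> nat \<Rightarrow> 'a \<Rightarrow> 'a set" where
  "image_iter f n z = ((\<lambda>A. \<Union>y\<in>A. f y) ^^ n) {z}"

definition postcritical_set :: "nat \<Rightarrow> nat \<Rightarrow> complex \<Rightarrow> complex set" where
  "postcritical_set p q c = closure (\<Union>n\<in>{0<..}. image_iter (corr p q c) n 0)"

definition omega_limit_set ::
    "nat \<Rightarrow> nat \<Rightarrow> complex \<Rightarrow> complex option \<Rightarrow> complex option set" where
  "omega_limit_set p q c z =
     {\<zeta>. \<exists>x r. forward_orbit (sphere_corr p q c) x \<and> x 0 = z \<and> strict_mono (r :: nat \<Rightarrow> nat) \<and>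
               limitin riemann_sphere (x \<circ> r) \<zeta> sequentially}"

definition alpha_limit_set :: "nat \<Rightarrow> nat \<Rightarrow> complex \<Rightarrow> complex \<Rightarrow> complex set" where
  "alpha_limit_set p q c z =
     {\<zeta>. \<exists>x r. backward_orbit (corr p q c) x \<and> x 0 = z \<and> strict_mono (r :: nat \<Rightarrow> nat) \<and>
               (x \<circ> r) \<longlonglongrightarrow> \<zeta>}"

definition hyperbolic :: "nat \<Rightarrow> nat \<Rightarrow> complex \<Rightarrow> bool" where
  "hyperbolic p q c \<longleftrightarrow>
     topspace riemann_sphere - Some ` julia_set p q c =
     {z \<in> topspace riemann_sphere.
        omega_limit_set p q c z \<subseteq> Some ` dual_julia_set p q c \<union> {None}}"

end

theory Submission
  imports Defs "HOL-Complex_Analysis.Complex_Analysis"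
begin

text \<open>
  All parameters in question share one property: a bounded forward orbit of the critical point
  \<open>0\<close> comes back to \<open>0\<close> (\<open>critical_orbits_return\<close>).  Outside \<open>M\<close> there is no bounded orbit of \<open>0\<close>,
  and at a simple centre the only one is a cycle through \<open>0\<close>.  By Koenig's lemma the part of the
  post-critical orbit inside a large disc is then finite, and apart from the edges at \<open>0\<close> it is
  an acyclic graph.  Every branch vanishes at \<open>0\<close> (up to the constant \<open>c\<close>) to order \<open>p/q > 1\<close>; this
  superattraction pays for the bounded expansion along the rest of the graph.  So there are
  disjoint closed discs around the finitely many points which the correspondence maps into the
  interiors of one another or out of the large disc, and which it contracts by \<open>1/2\<close> when lengths
  are measured in units of the radii.  Such a configuration is the locale \<open>trap\<close>.  Its conditions
  are strict, so the same discs work for all nearby \<open>c\<close> (\<open>trap_exists_near\<close>): this makes \<open>H\<close> open,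
  and all that remains is to study one parameter that has a trap.

  Let \<open>E\<close> be the union of the discs and \<open>W\<close> the rest of the large disc.  The critical value \<open>c\<close> lies
  in \<open>E\<close>, so that inverse branches continue along every holomorphic map from a disc into \<open>W\<close>, and the
  preimage of \<open>W\<close> keeps a positive distance from the complement of \<open>W\<close>.  A lifted disc can therefore
  be enlarged by a fixed factor without leaving \<open>W\<close>; hence inverse branches contract
  exponentially (\<open>disc_contraction\<close>).  This is the strict Schwarz lemma for the Kobayashi metric
  of \<open>W\<close>, expressed by discs in \<open>W\<close>.  As a plane disc minus
  disjoint discs, \<open>W\<close> is connected, and so a backward orbit of one point of \<open>W\<close> is shadowed,
  exponentially well, by backward orbits of any other point.  Let the repeller be the set of points
  with an orbit that stays in \<open>W\<close>.  Shadowing shows that backward orbits of each point of \<open>W\<close> come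
  close to each point of the repeller.  In particular a point of the repeller has preimages close
  to itself, and \<open>closing_lemma\<close>, a fixed point theorem for multivalued contractions, turns
  this into a repelling cycle nearby.  So the Julia set is the repeller (\<open>julia_set_eq\<close>).

  In \<open>E\<close> the correspondence itself contracts.  No repelling cycle meets \<open>E\<close>, the attracting cycles
  all lie in \<open>E\<close>, and the same closing lemma shows that limit points of orbits in \<open>E\<close> are limits of
  attracting cycles.  An orbit that is neither unbounded nor in the repeller ends up in \<open>E\<close>, and this
  gives hyperbolicity.  For backward orbits, contraction means that the starting point of a
  backward orbit that remains in \<open>E\<close> is a limit of orbits of \<open>0\<close>.  Backward orbits
  of a point outside the post-critical set thus enter \<open>W\<close> and accumulate exactly on the repeller.
\<close>

section \<open>The correspondence as a multivalued map\<close>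

text \<open>All values of the correspondence at a point lie on one circle about \<open>c\<close>.
  This is the source of the escape estimate and of the size of the derivative.\<close>

lemma corr_norm:
  assumes "q \<ge> 1" "p \<ge> 1" "w \<in> corr p q c z"
  shows "norm (w - c) = norm z powr (real p / real q)"
proof (cases "z = 0")
  case True
  with assms have "(w - c) ^ q = 0" by (simp add: corr_def zero_power)
  with True show ?thesis by simp
next
  case False
  have "(norm z powr (real p / real q)) ^ q = norm z ^ p"
  proof -
    have "(norm z powr (real p / real q)) ^ q = (norm z powr (real p / real q)) powr real q"
      using False by (simp add: powr_realpow)
    also have "\<dots> = norm z powr real p" using assms by (simp add: powr_powr)
    also have "\<dots> = norm z ^ p" using False by (simp add: powr_realpow)
    finally show ?thesis .
  qed
  also have "\<dots> = norm (w - c) ^ q"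
    using assms by (simp add: corr_def flip: norm_power)
  finally show ?thesis
    using assms by (auto dest: power_eq_imp_eq_base)
qed

lemma nth_root_exists:
  fixes a :: complex
  assumes "n \<ge> 1"
  shows "\<exists>u. u ^ n = a"
proof (cases "a = 0")
  case True
  then show ?thesis using assms by (intro exI[of _ 0]) auto
next
  case False
  have "exp (Ln a / of_nat n) ^ n = a"
    using False assms by (simp flip: exp_of_nat_mult)
  then show ?thesis by blast
qed

lemma corr_nonempty:
  assumes "q \<ge> 1" shows "\<exists>w. w \<in> corr p q c z"
proof -
  obtain u where "u ^ q = z ^ p" using nth_root_exists[OF assms] by blast
  then have "u + c \<in> corr p q c z" by (simp add: corr_def)
  then show ?thesis ..
qed

lemma corr_preimage:
  assumes "p \<ge> 1" shows "\<exists>z. w \<in> corr p q c z"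
proof -
  obtain z where "z ^ p = (w - c) ^ q" using nth_root_exists[OF assms] by blast
  then have "w \<in> corr p q c z" by (simp add: corr_def)
  then show ?thesis ..
qed

lemma finite_corr:
  assumes "q \<ge> 1" shows "finite (corr p q c z)"
proof -
  have "corr p q c z = (\<lambda>u. u + c) ` {u. u ^ q = z ^ p}"
  proof (intro set_eqI iffI)
    fix w assume "w \<in> corr p q c z"
    then have "w - c \<in> {u. u ^ q = z ^ p}" by (simp add: corr_def)
    then show "w \<in> (\<lambda>u. u + c) ` {u. u ^ q = z ^ p}" by (rule rev_image_eqI) simp
  qed (auto simp: corr_def)
  then show ?thesis using finite_nth_roots[of q "z ^ p"] assms by simp
qed

lemma corr_zero: "p \<ge> 1 \<Longrightarrow> q \<ge> 1 \<Longrightarrow> corr p q c 0 = {c}"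
  by (simp add: corr_def zero_power)

lemma corr_shift: "w \<in> corr p q c' z \<longleftrightarrow> w + (c - c') \<in> corr p q c z"
  by (simp add: corr_def algebra_simps)

lemma corr_limit:
  assumes "x \<longlonglongrightarrow> a" "y \<longlonglongrightarrow> b" "\<And>n. y n \<in> corr p q c (x n)"
  shows "b \<in> corr p q c a"
proof -
  have "(\<lambda>n. (y n - c) ^ q) \<longlonglongrightarrow> (b - c) ^ q" "(\<lambda>n. x n ^ p) \<longlonglongrightarrow> a ^ p"
    using assms by (auto intro!: tendsto_intros)
  moreover have "(\<lambda>n. (y n - c) ^ q) = (\<lambda>n. x n ^ p)"
    using assms(3) by (auto simp: corr_def)
  ultimately show ?thesis unfolding corr_def using LIMSEQ_unique by auto
qed

text \<open>The modulus of the derivative of every branch at a point of modulus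
  \<open>t\<close>.\<close>

definition lip :: "nat \<Rightarrow> nat \<Rightarrow> real \<Rightarrow> real" where
  "lip p q t = real p / real q * t powr (real p / real q - 1)"

lemma lip_nonneg: "0 \<le> lip p q t"
  by (simp add: lip_def)

lemma lip_mono: "q \<ge> 1 \<Longrightarrow> p > q \<Longrightarrow> 0 \<le> s \<Longrightarrow> s \<le> t \<Longrightarrow> lip p q s \<le> lip p q t"
  unfolding lip_def by (intro mult_left_mono powr_mono2) auto

text \<open>The angular half of the Lipschitz estimate: the chord that belongs to an angle
  multiplied by \<open>k\<close> is at most \<open>k\<close> times the original chord. For small
  angles this is concavity; beyond that the left-hand side is at most \<open>1\<close>, a value
  that the right-hand side has already reached.\<close>

lemma abs_sin_mult_le:
  fixes k t :: real
  assumes "1 \<le> k" "0 \<le> t" "t \<le> pi / 2"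
  shows "\<bar>sin (k * t)\<bar> \<le> k * sin t"
proof -
  have small: "sin (k * s) \<le> k * sin s" if "0 \<le> s" "k * s \<le> pi / 2" for s
  proof -
    have "(\<lambda>s. k * sin s - sin (k * s)) 0 \<le> (\<lambda>s. k * sin s - sin (k * s)) s"
    proof (rule DERIV_nonneg_imp_nondecreasing[OF \<open>0 \<le> s\<close>])
      fix x assume x: "0 \<le> x" "x \<le> s"
      have "x \<le> k * x" using mult_right_mono[OF assms(1) x(1)] by simp
      moreover have "k * x \<le> k * s" using x assms by (intro mult_left_mono) auto
      then have "k * x \<le> pi" using that pi_gt_zero by linarith
      ultimately have "cos (k * x) \<le> cos x"
        using x by (intro cos_monotone_0_pi_le) auto
      then have "0 \<le> k * cos x - k * cos (k * x)" using assms(1) by simp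
      moreover have "((\<lambda>s. k * sin s - sin (k * s)) has_real_derivative k * cos x - k * cos (k * x)) (at x)"
        by (auto intro!: derivative_eq_intros)
      ultimately show "\<exists>y. ((\<lambda>s. k * sin s - sin (k * s)) has_real_derivative y) (at x) \<and> 0 \<le> y"
        by blast
    qed
    then show ?thesis by simp
  qed
  show ?thesis
  proof (cases "k * t \<le> pi / 2")
    case True
    have "0 \<le> sin (k * t)" using True assms pi_gt_zero by (intro sin_ge_zero) auto
    then show ?thesis using small[OF assms(2) True] by simp
  next
    case False
    define t0 where "t0 = pi / (2 * k)"
    have k: "k * t0 = pi / 2" "0 \<le> t0" using assms by (auto simp: t0_def)
    have "t0 \<le> t" using False k assms by (smt (verit) mult_left_mono)
    have "1 \<le> k * sin t0" using small[of t0] k by simp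
    also have "\<dots> \<le> k * sin t"
      using \<open>t0 \<le> t\<close> k assms by (intro mult_left_mono sin_monotone_2pi_le) auto
    finally show ?thesis using abs_sin_le_one[of "k * t"] by linarith
  qed
qed

lemma powr_diff_le:
  fixes k :: real
  assumes "1 \<le> k" "0 < s" "s \<le> T" "0 < s'" "s' \<le> T"
  shows "\<bar>s powr k - s' powr k\<bar> \<le> k * T powr (k - 1) * \<bar>s - s'\<bar>"
proof -
  have "norm (s powr k - s' powr k) \<le> k * T powr (k - 1) * norm (s - s')"
  proof (rule field_differentiable_bound[where S = "{0<..T}" and f' = "\<lambda>x. k * x powr (k - 1)"])
    show "((\<lambda>x. x powr k) has_real_derivative k * z powr (k - 1)) (at z within {0<..T})"
      if "z \<in> {0<..T}" for z
      using that by (intro has_real_derivative_powr[THEN has_field_derivative_at_within]) simp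
    show "norm (k * z powr (k - 1)) \<le> k * T powr (k - 1)" if "z \<in> {0<..T}" for z
      using that assms by (auto simp: abs_mult intro!: mult_left_mono powr_mono2)
  qed (use assms in auto)
  then show ?thesis by simp
qed

lemma norm_exp_minus_1_sq:
  "(norm (exp s - 1))\<^sup>2 = (exp (Re s) - 1)\<^sup>2 + 4 * exp (Re s) * (sin (Im s / 2))\<^sup>2"
proof -
  define E t where "E = exp (Re s)" and "t = Im s / 2"
  have c: "cos (Im s) = 1 - 2 * (sin t)\<^sup>2"
    using cos_double_sin[of t] by (simp add: t_def)
  have "(norm (exp s - 1))\<^sup>2 = (E * cos (Im s) - 1)\<^sup>2 + (E * sin (Im s))\<^sup>2"
    by (simp add: cmod_power2 Re_exp Im_exp E_def)
  also have "\<dots> = E\<^sup>2 * ((cos (Im s))\<^sup>2 + (sin (Im s))\<^sup>2) - 2 * E * cos (Im s) + 1"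
    by (simp only: power2_eq_square algebra_simps)
  also have "\<dots> = E\<^sup>2 - 2 * E * (1 - 2 * (sin t)\<^sup>2) + 1"
    by (simp only: sin_cos_squared_add2 mult_1_right) (simp only: c)
  also have "\<dots> = (E - 1)\<^sup>2 + 4 * E * (sin t)\<^sup>2"
    by (simp add: power2_eq_square algebra_simps)
  finally show ?thesis by (simp add: E_def t_def)
qed

text \<open>Moving the base point moves each value along with Lipschitz constant \<open>lip p q
  T\<close>, even across the branch point \<open>0\<close>, because the exponent
  \<open>p/q\<close> exceeds \<open>1\<close>. The value is continued along the power with
  exponent \<open>p/q\<close> of \<open>z'/z\<close>, the principal logarithm giving an angle of
  at most \<open>\<pi>\<close>. Squared distances split into a radial and an angular part, and the
  two parts are compared separately.\<close>

lemma corr_lipschitz: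
  assumes q: "q \<ge> 1" and p: "p > q" and z: "norm z \<le> T" and z': "norm z' \<le> T"
    and w: "w \<in> corr p q c z"
  shows "\<exists>w'\<in>corr p q c z'. norm (w' - w) \<le> lip p q T * norm (z' - z)"
proof -
  define k where "k = real p / real q"
  have k: "1 \<le> k" "k > 0" using q p by (auto simp: k_def)
  have p1: "p \<ge> 1" using q p by simp
  have T: "0 \<le> T" using z norm_ge_zero order_trans by blast
  have lip: "lip p q T = k * T powr (k - 1)" by (simp add: lip_def k_def)
  have lip1: "T powr (k - 1) \<le> lip p q T"
    unfolding lip using k by (simp add: mult_right_le_one_le mult_le_cancel_right1)
  have grow: "s powr k \<le> lip p q T * s" if "0 \<le> s" "s \<le> T" for s
  proof (cases "s = 0")
    case False
    then have "s powr k = s powr (k - 1) * s" using that by (simp add: powr_diff)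
    also have "\<dots> \<le> T powr (k - 1) * s"
      using that k by (intro mult_right_mono powr_mono2) auto
    also have "\<dots> \<le> lip p q T * s" using lip1 that by (intro mult_right_mono) auto
    finally show ?thesis .
  qed simp
  consider "z = 0" | "z' = 0" | "z \<noteq> 0" "z' \<noteq> 0" by blast
  then show ?thesis
  proof cases
    case 1
    then have "w = c" using w q p1 by (simp add: corr_zero)
    obtain w' where w': "w' \<in> corr p q c z'" using corr_nonempty q by blast
    have "norm (w' - c) = norm z' powr k" using corr_norm[OF q p1 w'] by (simp add: k_def)
    also have "\<dots> \<le> lip p q T * norm (z' - z)" using grow[of "norm z'"] z' 1 by simp
    finally show ?thesis using w' \<open>w = c\<close> by blast
  next
    case 2
    have "norm (w - c) = norm z powr k" using corr_norm[OF q p1 w] by (simp add: k_def)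
    also have "\<dots> \<le> lip p q T * norm (z' - z)" using grow[of "norm z"] z 2 by simp
    finally show ?thesis using 2 q p1 by (auto simp: corr_zero norm_minus_commute)
  next
    case 3
    define s where "s = Ln (z' / z)"
    have es: "exp s = z' / z" using 3 by (simp add: s_def)
    define w' where "w' = c + (w - c) * exp (of_real k * s)"
    have "exp (of_real k * s) ^ q = exp s ^ p"
      using q by (simp add: k_def flip: exp_of_nat_mult)
    then have "(w' - c) ^ q = z ^ p * (z' / z) ^ p"
      using w by (simp add: w'_def power_mult_distrib es corr_def)
    also have "\<dots> = z' ^ p" using 3 by (simp add: power_divide)
    finally have w'c: "w' \<in> corr p q c z'" by (simp add: corr_def)
    define A B \<tau> where "A = norm z" and "B = norm z'" and "\<tau> = Im s / 2"
    have AB: "A > 0" "B > 0" "A \<le> T" "B \<le> T" using 3 z z' by (auto simp: A_def B_def)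
    have BA: "exp (Re s) = B / A"
      using es by (metis A_def B_def norm_divide norm_exp_eq_Re)
    have BAk: "exp (k * Re s) = B powr k / A powr k"
    proof -
      have "exp (k * Re s) = exp (Re s) powr k" by (simp add: exp_powr_real mult.commute)
      also have "\<dots> = B powr k / A powr k" unfolding BA using AB by (simp add: powr_divide)
      finally show ?thesis .
    qed
    have \<tau>: "\<bar>\<tau>\<bar> \<le> pi / 2"
      using 3 mpi_less_Im_Ln[of "z'/z"] Im_Ln_le_pi[of "z'/z"] by (simp add: \<tau>_def s_def)
    have "\<bar>sin (k * \<bar>\<tau>\<bar>)\<bar> \<le> k * sin \<bar>\<tau>\<bar>"
      using k \<tau> by (intro abs_sin_mult_le) auto
    then have "\<bar>sin (k * \<tau>)\<bar> \<le> \<bar>k * sin \<tau>\<bar>"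
      by (cases "0 \<le> \<tau>") simp_all
    then have sin2: "(sin (k * \<tau>))\<^sup>2 \<le> (k * sin \<tau>)\<^sup>2"
      by (simp only: abs_le_square_iff)
    have zz: "(norm (z' - z))\<^sup>2 = (B - A)\<^sup>2 + 4 * A * B * (sin \<tau>)\<^sup>2"
    proof -
      have "z' - z = z * (exp s - 1)" using 3 by (simp add: es field_simps)
      then have "(norm (z' - z))\<^sup>2 = A\<^sup>2 * (norm (exp s - 1))\<^sup>2"
        by (simp add: norm_mult power_mult_distrib A_def)
      also have "\<dots> = (A * (B / A - 1))\<^sup>2 + 4 * (A\<^sup>2 * (B / A)) * (sin \<tau>)\<^sup>2"
        by (simp add: norm_exp_minus_1_sq BA \<tau>_def power_mult_distrib distrib_left)
      also have "\<dots> = (B - A)\<^sup>2 + 4 * A * B * (sin \<tau>)\<^sup>2"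
        using AB by (simp add: right_diff_distrib power2_eq_square)
      finally show ?thesis .
    qed
    define Ak Bk where "Ak = A powr k" and "Bk = B powr k"
    have AkBk: "Ak > 0" "Bk > 0" using AB by (auto simp: Ak_def Bk_def)
    \<comment> \<open>The same splitting as in \<open>zz\<close>, with the modulus raised to the
      power \<open>k\<close> and the angle multiplied by \<open>k\<close>.\<close>
    have ww: "(norm (w' - w))\<^sup>2 = (Bk - Ak)\<^sup>2 + 4 * (Ak * Bk) * (sin (k * \<tau>))\<^sup>2"
    proof -
      have "w' - w = (w - c) * (exp (of_real k * s) - 1)" by (simp add: w'_def algebra_simps)
      then have "(norm (w' - w))\<^sup>2 = Ak\<^sup>2 * (norm (exp (of_real k * s) - 1))\<^sup>2"
        using corr_norm[OF q p1 w] by (simp add: norm_mult power_mult_distrib A_def Ak_def k_def)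
      also have "\<dots> = (Ak * (Bk / Ak - 1))\<^sup>2 + 4 * (Ak\<^sup>2 * (Bk / Ak)) * (sin (k * \<tau>))\<^sup>2"
        by (simp add: norm_exp_minus_1_sq BAk \<tau>_def power_mult_distrib distrib_left Ak_def Bk_def)
      also have "\<dots> = (Bk - Ak)\<^sup>2 + 4 * (Ak * Bk) * (sin (k * \<tau>))\<^sup>2"
        using AkBk by (simp add: right_diff_distrib power2_eq_square)
      finally show ?thesis .
    qed
    define Q where "Q = T powr (k - 1)"
    have s1: "(Bk - Ak)\<^sup>2 \<le> (k * Q * (B - A))\<^sup>2"
    proof -
      have "\<bar>Bk - Ak\<bar> \<le> k * Q * \<bar>B - A\<bar>"
        unfolding Ak_def Bk_def Q_def using k AB by (intro powr_diff_le) auto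
      also have "\<dots> = \<bar>k * Q * (B - A)\<bar>" using k by (simp add: abs_mult Q_def)
      finally show ?thesis by (simp add: abs_le_square_iff)
    qed
    have s2: "4 * (Ak * Bk) * (sin (k * \<tau>))\<^sup>2 \<le> 4 * ((Q * A) * (Q * B)) * (k * sin \<tau>)\<^sup>2"
    proof -
      have "Ak \<le> Q * A"
      proof -
        have "Ak = A powr (k - 1) * A" using AB by (simp add: Ak_def powr_diff)
        also have "\<dots> \<le> Q * A" unfolding Q_def using AB k by (intro mult_right_mono powr_mono2) auto
        finally show ?thesis .
      qed
      moreover have "Bk \<le> Q * B"
      proof -
        have "Bk = B powr (k - 1) * B" using AB by (simp add: Bk_def powr_diff)
        also have "\<dots> \<le> Q * B" unfolding Q_def using AB k by (intro mult_right_mono powr_mono2) auto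
        finally show ?thesis .
      qed
      ultimately have "Ak * Bk \<le> (Q * A) * (Q * B)"
        using AkBk AB by (intro mult_mono) (auto simp: Q_def)
      then have "4 * (Ak * Bk) \<le> 4 * ((Q * A) * (Q * B))" by linarith
      moreover have "0 \<le> Q * A" "0 \<le> Q * B" using AB by (auto simp: Q_def)
      then have "0 \<le> 4 * ((Q * A) * (Q * B))" by (simp only: mult_nonneg_nonneg zero_le_numeral)
      ultimately show ?thesis by (rule mult_mono[OF _ sin2]) simp
    qed
    have "(norm (w' - w))\<^sup>2 \<le> (k * Q * (B - A))\<^sup>2 + 4 * ((Q * A) * (Q * B)) * (k * sin \<tau>)\<^sup>2"
      using add_mono[OF s1 s2] ww by simp
    also have "\<dots> = (k * Q)\<^sup>2 * ((B - A)\<^sup>2 + 4 * A * B * (sin \<tau>)\<^sup>2)"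
      by (simp add: power_mult_distrib distrib_left power2_eq_square)
    also have "\<dots> = (k * Q * norm (z' - z))\<^sup>2"
      by (simp only: zz power_mult_distrib)
    finally have "norm (w' - w) \<le> k * Q * norm (z' - z)"
      by (rule power2_le_imp_le) (use k in \<open>simp add: Q_def\<close>)
    then show ?thesis using w'c by (auto simp: lip Q_def)
  qed
qed

section \<open>Branches and multipliers\<close>

text \<open>Existence of branches in both directions: with \<open>F\<close> the identity this
  gives forward branches off \<open>0\<close>, with \<open>F = g - c\<close> it lifts a
  holomorphic map through the inverse correspondence.\<close>

lemma root_lift:
  fixes F :: "complex \<Rightarrow> complex"
  assumes "convex S" "F holomorphic_on S" "\<And>z. z \<in> S \<Longrightarrow> F z \<noteq> 0"
    and u: "u \<in> S" and m: "m > 0" and h0: "h0 ^ m = F u ^ k"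
  shows "\<exists>h. h holomorphic_on S \<and> h u = h0 \<and> (\<forall>z\<in>S. h z ^ m = F z ^ k)"
proof -
  obtain g where g: "g holomorphic_on S" "\<And>z. z \<in> S \<Longrightarrow> F z = exp (g z)"
    using contractible_imp_holomorphic_log[OF assms(2) convex_imp_contractible[OF assms(1)] assms(3)]
    by blast
  define h where "h = (\<lambda>z. h0 * exp (of_nat k / of_nat m * (g z - g u)))"
  have "h holomorphic_on S" unfolding h_def by (intro holomorphic_intros g)
  moreover have "h u = h0" by (simp add: h_def)
  moreover have "h z ^ m = F z ^ k" if "z \<in> S" for z
  proof -
    have "h z ^ m = F u ^ k * exp (of_nat m * (of_nat k / of_nat m * (g z - g u)))"
      by (simp add: h_def power_mult_distrib h0 flip: exp_of_nat_mult)
    also have "of_nat m * (of_nat k / of_nat m * (g z - g u)) = of_nat k * (g z - g u)"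
      using m by simp
    also have "exp (of_nat k * (g z - g u)) = (F z / F u) ^ k"
      using g(2) that u by (simp add: exp_of_nat_mult exp_diff)
    finally show ?thesis using assms(3)[OF u] by (simp add: power_divide)
  qed
  ultimately show ?thesis by blast
qed

text \<open>Logarithmic differentiation of \<open>h ^ m = F ^ k\<close>.\<close>

lemma root_deriv:
  fixes F :: "complex \<Rightarrow> complex"
  assumes "open S" "F holomorphic_on S" "h holomorphic_on S" "\<And>z. z \<in> S \<Longrightarrow> h z ^ m = F z ^ k"
    and u: "u \<in> S" and m: "m > 0" and k: "k > 0" and nz: "F u \<noteq> 0"
  shows "deriv h u = of_nat k / of_nat m * h u * deriv F u / F u"
proof -
  have dF: "(F has_field_derivative deriv F u) (at u)" and dh: "(h has_field_derivative deriv h u) (at u)"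
    using assms holomorphic_derivI by blast+
  have 1: "((\<lambda>z. h z ^ m) has_field_derivative of_nat m * (deriv h u * h u ^ (m - 1))) (at u)"
    using DERIV_power[OF dh, of m] by simp
  have "((\<lambda>z. F z ^ k) has_field_derivative of_nat k * (deriv F u * F u ^ (k - 1))) (at u)"
    using DERIV_power[OF dF, of k] by simp
  then have 2: "((\<lambda>z. h z ^ m) has_field_derivative of_nat k * (deriv F u * F u ^ (k - 1))) (at u)"
    by (rule has_field_derivative_transform_within_open[OF _ assms(1) u]) (simp add: assms(4))
  have eq: "of_nat m * (deriv h u * h u ^ (m - 1)) = of_nat k * (deriv F u * F u ^ (k - 1))"
    using DERIV_unique[OF 1 2] .
  have hm: "h u ^ (m - 1) * h u = F u ^ k"
    using assms(4)[OF u] m by (metis power_minus_mult)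
  have Fk: "F u ^ (k - 1) * F u = F u ^ k"
    using k by (metis power_minus_mult)
  have "of_nat m * deriv h u * F u * F u ^ k = of_nat m * (deriv h u * h u ^ (m - 1)) * h u * F u"
    unfolding hm[symmetric] by (simp add: ac_simps)
  also have "\<dots> = of_nat k * deriv F u * h u * F u ^ k"
    unfolding eq Fk[symmetric] by (simp add: ac_simps)
  finally have "of_nat m * deriv h u * F u = of_nat k * deriv F u * h u"
    using nz by simp
  then show ?thesis using nz m by (simp add: field_simps)
qed

lemma deriv_branch:
  assumes "q \<ge> 1" "p \<ge> 1" "is_branch p q c U \<phi>" "z \<in> U" "z \<noteq> 0"
  shows "deriv \<phi> z = of_nat p / of_nat q * (\<phi> z - c) / z"
proof -
  have U: "open U" "\<phi> holomorphic_on U" "\<And>z. z \<in> U \<Longrightarrow> (\<phi> z - c) ^ q = z ^ p"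
    using assms(3) by (auto simp: is_branch_def)
  have "deriv (\<lambda>z. \<phi> z - c) z = of_nat p / of_nat q * (\<phi> z - c) * deriv (\<lambda>z. z) z / z"
    using assms U by (intro root_deriv[where S = U]) (auto intro!: holomorphic_intros)
  moreover have "deriv (\<lambda>z. \<phi> z - c) z = deriv \<phi> z"
    using U assms(4) holomorphic_on_imp_differentiable_at by (subst deriv_diff) auto
  ultimately show ?thesis by simp
qed

lemma branch_exists:
  assumes "q \<ge> 1" "w \<in> corr p q c z" "z \<noteq> 0"
  shows "\<exists>\<phi> U. is_branch p q c U \<phi> \<and> z \<in> U \<and> \<phi> z = w"
proof -
  define U where "U = ball z (norm z)"
  have "z \<in> U" using assms by (simp add: U_def)
  have "\<exists>h. h holomorphic_on U \<and> h z = w - c \<and> (\<forall>v\<in>U. h v ^ q = v ^ p)"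
  proof (rule root_lift)
    show "v \<noteq> 0" if "v \<in> U" for v using that by (auto simp: U_def)
  qed (use assms \<open>z \<in> U\<close> in \<open>auto simp: U_def corr_def\<close>)
  then obtain h where h: "h holomorphic_on U" "h z = w - c" "\<forall>v\<in>U. h v ^ q = v ^ p"
    by blast
  then have "is_branch p q c U (\<lambda>z. h z + c)" "h z + c = w"
    by (auto simp: is_branch_def U_def intro!: holomorphic_intros)
  then show ?thesis using \<open>z \<in> U\<close> by (intro exI[of _ "\<lambda>z. h z + c"] exI[of _ U]) auto
qed

text \<open>The multiplier written in terms of the points of the cycle alone. In particular it
  exists and is unique.\<close>

lemma is_multiplier_iff:
  assumes "q \<ge> 1" "p \<ge> 1" "is_cycle p q c n x" "0 \<notin> range x"
  shows "is_multiplier p q c n x l \<longleftrightarrow>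
    l = (\<Prod>i<n. of_nat p / of_nat q * (x (Suc i) - c) / x i)"
proof
  have nz: "x i \<noteq> 0" for i using assms(4) by (metis rangeI)
  show "l = (\<Prod>i<n. of_nat p / of_nat q * (x (Suc i) - c) / x i)" if "is_multiplier p q c n x l"
  proof -
    from that obtain \<phi> U where
      U: "\<And>i. i < n \<Longrightarrow> is_branch p q c (U i) (\<phi> i) \<and> x i \<in> U i \<and> \<phi> i (x i) = x (Suc i)"
      and l: "l = (\<Prod>i<n. deriv (\<phi> i) (x i))"
      unfolding is_multiplier_def by blast
    show ?thesis unfolding l
      using U deriv_branch[OF assms(1,2) _ _ nz] by (intro prod.cong) (simp_all, metis)
  qed
  show "is_multiplier p q c n x l" if l: "l = (\<Prod>i<n. of_nat p / of_nat q * (x (Suc i) - c) / x i)"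
  proof -
    have "\<forall>i. \<exists>\<phi> U. is_branch p q c U \<phi> \<and> x i \<in> U \<and> \<phi> (x i) = x (Suc i)"
      using branch_exists[OF assms(1) _ nz] assms(3) by (simp add: is_cycle_def forward_orbit_def)
    then obtain \<phi> U where U: "\<And>i. is_branch p q c (U i) (\<phi> i) \<and> x i \<in> U i \<and> \<phi> i (x i) = x (Suc i)"
      by metis
    then have "l = (\<Prod>i<n. deriv (\<phi> i) (x i))"
      unfolding l using deriv_branch[OF assms(1,2) _ _ nz] by (intro prod.cong) (simp_all, metis)
    then show ?thesis unfolding is_multiplier_def using U by blast
  qed
qed

section \<open>A closing lemma for multivalued contractions\<close>

lemma convergent_if_geometric_increments:
  fixes f :: "nat \<Rightarrow> 'a::banach"
  assumes "\<And>m. norm (f (Suc m) - f m) \<le> K * (1 / 2) ^ m"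
  shows "convergent f"
proof -
  have "summable (\<lambda>m. K * (1 / 2 :: real) ^ m)"
    by (intro summable_mult summable_geometric) simp
  then have "summable (\<lambda>m. f (Suc m) - f m)"
    by (rule summable_comparison_test') (use assms in auto)
  then have "convergent (\<lambda>n. \<Sum>m<n. f (Suc m) - f m)"
    by (simp add: summable_iff_convergent)
  then have "convergent (\<lambda>n. f n - f 0)"
    by (simp add: sum_lessThan_telescope)
  then have "convergent (\<lambda>n. (f n - f 0) + f 0)"
    by (intro convergent_add convergent_const)
  then show ?thesis by simp
qed

text \<open>If an orbit nearly returns after \<open>n\<close> steps, and orbits near it can be
  followed from any nearby starting point with total contraction by a factor of at most
  \<open>1/2\<close>, then there is a genuine cycle nearby. Starting the next orbit segment where
  the previous one ended produces segments whose mismatch halves each time; they converge, and the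
  limit closes up since the graph is closed. Only a selection of values is followed, so the lemma
  applies near branch points, and both to the correspondence and to its inverse.\<close>

lemma closing_lemma:
  fixes F :: "complex \<Rightarrow> complex set" and x :: "nat \<Rightarrow> complex" and e :: "nat \<Rightarrow> real"
  assumes cl: "\<And>X Y a b. X \<longlonglongrightarrow> a \<Longrightarrow> Y \<longlonglongrightarrow> b \<Longrightarrow> (\<And>m. Y m \<in> F (X m)) \<Longrightarrow> b \<in> F a"
    and n: "n \<ge> 1" and orb: "forward_orbit F x"
    and e0: "e 0 = 1" and en: "e n \<le> 1 / 2" and epos: "\<And>i. i \<le> n \<Longrightarrow> 0 \<le> e i"
    and near: "norm (x n - x 0) \<le> \<epsilon>"
    and track: "\<And>y v. forward_orbit F y \<Longrightarrow> (\<And>i. i \<le> n \<Longrightarrow> norm (y i - x i) \<le> 2 * \<epsilon> * e i) \<Longrightarrow>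
        norm (v - y 0) \<le> \<epsilon> \<Longrightarrow>
        \<exists>y'. forward_orbit F y' \<and> y' 0 = v \<and> (\<forall>i\<le>n. norm (y' i - y i) \<le> e i * norm (v - y 0))"
  shows "\<exists>y. forward_orbit F y \<and> (\<forall>i. y (i + n) = y i) \<and> (\<forall>i\<le>n. norm (y i - x i) \<le> 2 * \<epsilon> * e i)"
proof -
  have \<epsilon>: "0 \<le> \<epsilon>" using near norm_ge_zero order_trans by blast
  \<comment> \<open>The factor \<open>2 - 2 * (1/2) ^ m\<close> is the sum of the first
    \<open>m\<close> corrections, which keeps the segments in the range where \<open>track\<close>
    applies.\<close>
  define P where "P = (\<lambda>m Y. forward_orbit F Y \<and> norm (Y n - Y 0) \<le> \<epsilon> * (1 / 2) ^ m \<and>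
      (\<forall>i\<le>n. norm (Y i - x i) \<le> (2 - 2 * (1 / 2) ^ m) * \<epsilon> * e i))"
  define Q where "Q = (\<lambda>(m::nat) (Y :: nat \<Rightarrow> complex) Y'. Y' 0 = Y n \<and> (\<forall>i\<le>n. norm (Y' i - Y i) \<le> (\<epsilon> * e i) * (1 / 2) ^ m))"
  have "\<exists>S. \<forall>m. P m (S m) \<and> Q m (S m) (S (Suc m))"
  proof (rule dependent_nat_choice)
    show "\<exists>Y. P 0 Y" using orb near by (intro exI[of _ x]) (simp add: P_def)
    fix Y m assume Y: "P m Y"
    have le1: "(1 / 2 :: real) ^ m \<le> 1" by (intro power_le_one) auto
    have "\<epsilon> * (1 / 2) ^ m \<le> \<epsilon> * 1" using \<epsilon> le1 by (intro mult_left_mono)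
    then have small: "norm (Y n - Y 0) \<le> \<epsilon>" using Y unfolding P_def by linarith
    have "norm (Y i - x i) \<le> 2 * \<epsilon> * e i" if "i \<le> n" for i
    proof -
      have "(2 - 2 * (1 / 2) ^ m) * (\<epsilon> * e i) \<le> 2 * (\<epsilon> * e i)"
        using \<epsilon> epos[OF that] by (intro mult_right_mono) auto
      moreover have "norm (Y i - x i) \<le> (2 - 2 * (1 / 2) ^ m) * \<epsilon> * e i" using Y that by (simp add: P_def)
      ultimately show ?thesis by (simp add: mult.assoc)
    qed
    then obtain Y' where Y': "forward_orbit F Y'" "Y' 0 = Y n"
      and d: "\<And>i. i \<le> n \<Longrightarrow> norm (Y' i - Y i) \<le> e i * norm (Y n - Y 0)"
      using track[of Y "Y n"] Y small unfolding P_def by blast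
    have d': "norm (Y' i - Y i) \<le> (\<epsilon> * e i) * (1 / 2) ^ m" if "i \<le> n" for i
    proof -
      have "e i * norm (Y n - Y 0) \<le> e i * (\<epsilon> * (1 / 2) ^ m)"
        using Y epos[OF that] by (intro mult_left_mono) (auto simp: P_def)
      then show ?thesis using d[OF that] by (simp add: ac_simps)
    qed
    have "norm (Y' n - Y' 0) \<le> \<epsilon> * (1 / 2) ^ Suc m"
    proof -
      have "\<epsilon> * e n * (1 / 2) ^ m \<le> \<epsilon> * (1 / 2) * (1 / 2) ^ m"
        using \<epsilon> en by (intro mult_right_mono mult_left_mono) auto
      then show ?thesis using d'[of n] Y' by simp
    qed
    moreover have "norm (Y' i - x i) \<le> (2 - 2 * (1 / 2) ^ Suc m) * \<epsilon> * e i" if "i \<le> n" for i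
    proof -
      have "norm (Y' i - x i) \<le> norm (Y' i - Y i) + norm (Y i - x i)"
        using norm_triangle_ineq[of "Y' i - Y i" "Y i - x i"] by simp
      also have "\<dots> \<le> (\<epsilon> * e i) * (1 / 2) ^ m + (2 - 2 * (1 / 2) ^ m) * \<epsilon> * e i"
        using d'[OF that] Y that by (intro add_mono) (auto simp: P_def)
      also have "\<dots> = (2 - 2 * (1 / 2) ^ Suc m) * \<epsilon> * e i" by (simp add: algebra_simps)
      finally show ?thesis .
    qed
    ultimately have "P (Suc m) Y' \<and> Q m Y Y'" using Y' d' by (auto simp: P_def Q_def)
    then show "\<exists>Y'. P (Suc m) Y' \<and> Q m Y Y'" by blast
  qed
  then obtain S where S: "\<And>m. P m (S m)" "\<And>m. Q m (S m) (S (Suc m))" by blast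
  define L where "L = (\<lambda>i. lim (\<lambda>m. S m i))"
  have L: "(\<lambda>m. S m i) \<longlonglongrightarrow> L i" if "i \<le> n" for i
  proof -
    have "norm (S (Suc m) i - S m i) \<le> (\<epsilon> * e i) * (1 / 2) ^ m" for m
      using S(2)[of m] that by (simp add: Q_def)
    then have "convergent (\<lambda>m. S m i)" by (rule convergent_if_geometric_increments)
    then show ?thesis by (simp add: L_def convergent_LIMSEQ_iff)
  qed
  have step: "L (Suc i) \<in> F (L i)" if "i < n" for i
    using that S(1) by (intro cl[OF L[of i] L[of "Suc i"]]) (auto simp: P_def forward_orbit_def)
  have "(\<lambda>m. S (Suc m) 0) \<longlonglongrightarrow> L 0" using L[of 0] by (intro LIMSEQ_Suc) simp
  moreover have "(\<lambda>m. S (Suc m) 0) = (\<lambda>m. S m n)" using S(2) by (auto simp: Q_def)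
  ultimately have "(\<lambda>m. S m n) \<longlonglongrightarrow> L 0" by simp
  then have Ln: "L n = L 0" using L[of n] by (intro LIMSEQ_unique[of "\<lambda>m. S m n"]) simp_all
  define y where "y = (\<lambda>i. L (i mod n))"
  have "y (Suc i) \<in> F (y i)" for i
  proof -
    have "y (Suc i) = L (Suc (i mod n))" using Ln by (auto simp: y_def mod_Suc)
    then show ?thesis using step[of "i mod n"] n by (simp add: y_def)
  qed
  then have "forward_orbit F y" by (simp add: forward_orbit_def)
  moreover have "y (i + n) = y i" for i by (simp add: y_def)
  moreover have "norm (y i - x i) \<le> 2 * \<epsilon> * e i" if "i \<le> n" for i
  proof -
    have yi: "y i = L i" using that Ln by (cases "i = n") (auto simp: y_def)
    have "(\<lambda>m. norm (S m i - x i)) \<longlonglongrightarrow> norm (L i - x i)"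
      using L[OF that] by (intro tendsto_intros)
    moreover have "norm (S m i - x i) \<le> 2 * \<epsilon> * e i" for m
    proof -
      have "(2 - 2 * (1 / 2) ^ m) * (\<epsilon> * e i) \<le> 2 * (\<epsilon> * e i)"
        using \<epsilon> epos[OF that] by (intro mult_right_mono) auto
      moreover have "norm (S m i - x i) \<le> (2 - 2 * (1 / 2) ^ m) * \<epsilon> * e i"
        using S(1)[of m] that by (simp add: P_def)
      ultimately show ?thesis by (simp add: mult.assoc)
    qed
    ultimately show ?thesis unfolding yi by (intro LIMSEQ_le_const2) auto
  qed
  ultimately show ?thesis by blast
qed

section \<open>Traps\<close>

text \<open>A parameter \<open>c\<close> with an escape radius \<open>R\<close> and disjoint discs
  around the finite set \<open>A\<close>. The last inequality of \<open>step\<close> says that the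
  correspondence halves distances in units of the radii. The factor \<open>3\<close> leaves room
  for shadowing orbits that run outside the discs. Each disc contains a point of the orbit of
  \<open>0\<close>; so contraction relates everything that happens in the discs to the
  post-critical set.\<close>

locale trap =
  fixes p q :: nat and c :: complex and R :: real and A :: "complex set" and r :: "complex \<Rightarrow> real"
  assumes q1: "q \<ge> 1" and pq: "p > q" and Rpos: "R > 0"
    and escape: "\<And>z w. norm z \<ge> R \<Longrightarrow> w \<in> corr p q c z \<Longrightarrow> norm w \<ge> 2 * norm z"
    and finA: "finite A" and rpos: "\<And>a. a \<in> A \<Longrightarrow> r a > 0"
    and inside: "\<And>a. a \<in> A \<Longrightarrow> cball a (r a) \<subseteq> ball 0 R"
    and disj: "\<And>a b. a \<in> A \<Longrightarrow> b \<in> A \<Longrightarrow> a \<noteq> b \<Longrightarrow> cball a (r a) \<inter> cball b (r b) = {}"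
    and critical_value: "\<exists>b\<in>A. c \<in> ball b (r b)"
    and step: "\<And>a z w. a \<in> A \<Longrightarrow> z \<in> cball a (r a) \<Longrightarrow> w \<in> corr p q c z \<Longrightarrow> norm w \<le> R \<Longrightarrow>
       \<exists>b\<in>A. w \<in> ball b (r b) \<and> 2 * (lip p q (norm a + 3 * r a) * r a) \<le> r b"
    and postcritical: "\<And>a. a \<in> A \<Longrightarrow> \<exists>y\<in>(\<Union>n\<in>{0<..}. image_iter (corr p q c) n 0). norm (y - a) \<le> r a"
begin

abbreviation "f \<equiv> corr p q c"
definition "E = (\<Union>a\<in>A. cball a (r a))"
definition "W = ball 0 R - E"
text \<open>\<open>Q\<close> is a compact set slightly larger than \<open>W\<close>: the discs are
  removed without their boundaries.\<close>

definition "Q = cball 0 R - (\<Union>a\<in>A. ball a (r a))"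

lemma p1: "p \<ge> 1" using q1 pq by simp

lemma compact_E: "compact E"
  unfolding E_def using finA by (intro compact_UN) auto

lemma open_W: "open W"
  unfolding W_def using compact_E by (intro open_Diff compact_imp_closed) auto

lemma compact_Q: "compact Q"
  unfolding Q_def by (intro compact_diff open_UN) auto

lemma W_subset_Q: "W \<subseteq> Q"
  unfolding W_def Q_def E_def by (auto simp: less_imp_le)

lemma c_notin_W: "c \<notin> W"
proof -
  obtain b where "b \<in> A" "c \<in> cball b (r b)"
    using critical_value ball_subset_cball by blast
  then show ?thesis by (auto simp: W_def E_def)
qed

lemma W_norm: "z \<in> W \<Longrightarrow> norm z < R" by (simp add: W_def)

text \<open>The preimage of the compact set \<open>Q\<close> lies in the open set
  \<open>W\<close>: this is where the strictness of the trap conditions is used.\<close>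

lemma preimage_of_Q_in_W:
  assumes "w \<in> f z" "w \<in> Q" shows "z \<in> W"
proof -
  have wR: "norm w \<le> R" using assms by (simp add: Q_def)
  have "norm z < R" using escape[of z w] assms(1) wR Rpos by linarith
  moreover have "z \<notin> E"
  proof
    assume "z \<in> E"
    then obtain a where "a \<in> A" "z \<in> cball a (r a)" by (auto simp: E_def)
    from step[OF this assms(1) wR] show False using assms(2) by (auto simp: Q_def)
  qed
  ultimately show ?thesis by (simp add: W_def)
qed

lemma E_forward:
  assumes "z \<in> E" "w \<in> f z" "norm w \<le> R" shows "w \<in> E"
proof -
  obtain a where "a \<in> A" "z \<in> cball a (r a)" using assms(1) unfolding E_def by blast
  then obtain b where "b \<in> A" "w \<in> ball b (r b)" using step assms(2,3) by blast
  then show ?thesis using ball_subset_cball unfolding E_def by blast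
qed

text \<open>Janiszewski's theorem allows the discs, and finally the exterior of the large disc, to
  be removed one after the other.\<close>

lemma connected_W: "connected W"
proof -
  have "connected (- (\<Union>a\<in>B. cball a (r a)))" if "B \<subseteq> A" for B
    using finite_subset[OF that finA] that
  proof (induction B rule: finite_induct)
    case (insert a B)
    have "cball a (r a) \<inter> (\<Union>b\<in>B. cball b (r b)) = {}"
      using disj insert.hyps insert.prems by blast
    then have "connected (cball a (r a) \<inter> (\<Union>b\<in>B. cball b (r b)))" by simp
    moreover have "closed (\<Union>b\<in>B. cball b (r b))"
      using insert.hyps by (intro closed_UN) auto
    moreover have "connected (- cball a (r a))"
      by (intro connected_complement_bounded_convex) auto
    ultimately have "connected (- (cball a (r a) \<union> (\<Union>b\<in>B. cball b (r b))))"
      using insert by (intro Janiszewski_connected) auto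
    then show ?case by simp
  qed (simp add: connected_UNIV)
  then have "connected (- E)" unfolding E_def by blast
  moreover have "E \<inter> - ball 0 R = {}" using inside by (auto simp: E_def)
  ultimately have "connected (- (E \<union> - ball 0 R))"
    using compact_E by (intro Janiszewski_connected) auto
  moreover have "- (E \<union> - ball 0 R) = W" by (auto simp: W_def)
  ultimately show ?thesis by simp
qed

lemma compact_preimage:
  assumes "compact K" "compact L"
  shows "compact {z \<in> L. \<exists>w\<in>K. w \<in> f z}"
proof -
  have "closed {x :: complex \<times> complex. (snd x - c) ^ q = fst x ^ p}"
    by (intro closed_Collect_eq continuous_intros)
  then have "compact ((L \<times> K) \<inter> {x. (snd x - c) ^ q = fst x ^ p})"
    using assms by (intro compact_Int_closed compact_Times)
  then have "compact (fst ` ((L \<times> K) \<inter> {x. (snd x - c) ^ q = fst x ^ p}))"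
    by (intro compact_continuous_image continuous_intros)
  also have "fst ` ((L \<times> K) \<inter> {x. (snd x - c) ^ q = fst x ^ p}) = {z \<in> L. \<exists>w\<in>K. w \<in> f z}"
  proof (intro set_eqI iffI)
    fix z assume "z \<in> {z \<in> L. \<exists>w\<in>K. w \<in> f z}"
    then obtain w where "w \<in> K" "z \<in> L" "(w - c) ^ q = z ^ p" by (auto simp: corr_def)
    then show "z \<in> fst ` ((L \<times> K) \<inter> {x. (snd x - c) ^ q = fst x ^ p})"
      by (intro image_eqI[of _ _ "(z, w)"]) auto
  qed (auto simp: corr_def)
  finally show ?thesis .
qed

lemma margin_exists: "\<exists>d>0. \<forall>z w. w \<in> Q \<longrightarrow> w \<in> f z \<longrightarrow> ball z d \<subseteq> W"
proof -
  have sub: "{z \<in> cball 0 R. \<exists>w\<in>Q. w \<in> f z} \<subseteq> W" using preimage_of_Q_in_W by blast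
  obtain d where d: "d > 0" "(\<Union>z\<in>{z \<in> cball 0 R. \<exists>w\<in>Q. w \<in> f z}. ball z d) \<subseteq> W"
    by (rule compact_subset_open_imp_ball_epsilon_subset[OF compact_preimage[OF compact_Q compact_cball] open_W sub])
  have "ball z d \<subseteq> W" if "w \<in> Q" "w \<in> f z" for z w
  proof -
    have "z \<in> cball 0 R" using preimage_of_Q_in_W[OF that(2,1)] W_norm by (simp add: less_imp_le)
    then show ?thesis using d(2) that by blast
  qed
  then show ?thesis using d(1) by blast
qed

section \<open>Contraction of inverse branches\<close>

definition "margin = (SOME d. d > 0 \<and> (\<forall>z w. w \<in> Q \<longrightarrow> w \<in> f z \<longrightarrow> ball z d \<subseteq> W))"

lemma margin: "margin > 0" "w \<in> Q \<Longrightarrow> w \<in> f z \<Longrightarrow> ball z margin \<subseteq> W"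
proof -
  have *: "margin > 0 \<and> (\<forall>z w. w \<in> Q \<longrightarrow> w \<in> f z \<longrightarrow> ball z margin \<subseteq> W)"
    unfolding margin_def by (rule someI_ex[OF margin_exists])
  from * show "margin > 0" ..
  from * show "w \<in> Q \<Longrightarrow> w \<in> f z \<Longrightarrow> ball z margin \<subseteq> W" by blast
qed

text \<open>The factor \<open>1 + margin / (4 * R)\<close> is the amount by which a lifted disc
  can be enlarged inside \<open>W\<close>.\<close>

definition "rate = 1 / (1 + margin / (4 * R))"

lemma rate: "0 < rate" "rate < 1"
proof -
  have "0 < margin / (4 * R)" using margin(1) Rpos by simp
  then show "0 < rate" "rate < 1" by (simp_all add: rate_def)
qed

text \<open>The modulus of the derivative at \<open>w\<close> of the inverse branch that takes
  \<open>w\<close> to \<open>z\<close>.\<close>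

definition "inverse_slope w z = real q / real p * norm z / norm (w - c)"

lemma inverse_slope_nonneg: "0 \<le> inverse_slope w z" by (simp add: inverse_slope_def)

text \<open>Lifting is possible because \<open>c\<close>, the only branch point of the inverse
  correspondence, is not in \<open>W\<close>.\<close>

lemma preimage_lift:
  assumes "open S" "convex S" "g holomorphic_on S" "g ` S \<subseteq> W" "u \<in> S" "g u \<in> f z"
  shows "\<exists>h. h holomorphic_on S \<and> h u = z \<and> (\<forall>v\<in>S. g v \<in> f (h v)) \<and> h ` S \<subseteq> W \<and>
    (\<forall>v\<in>S. norm (deriv h v) = inverse_slope (g v) (h v) * norm (deriv g v))"
proof -
  have nz: "g v - c \<noteq> 0" if "v \<in> S" for v using assms(4) c_notin_W that by auto
  have "\<exists>h. h holomorphic_on S \<and> h u = z \<and> (\<forall>v\<in>S. h v ^ p = (g v - c) ^ q)"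
    using assms nz p1 by (intro root_lift) (auto intro!: holomorphic_intros simp: corr_def)
  then obtain h where h: "h holomorphic_on S" "h u = z" "\<And>v. v \<in> S \<Longrightarrow> h v ^ p = (g v - c) ^ q"
    by blast
  have gh: "g v \<in> f (h v)" if "v \<in> S" for v using h(3)[OF that] by (simp add: corr_def)
  have "h v \<in> W" if "v \<in> S" for v
    using preimage_of_Q_in_W[OF gh[OF that]] assms(4) W_subset_Q that by blast
  moreover have "norm (deriv h v) = inverse_slope (g v) (h v) * norm (deriv g v)" if "v \<in> S" for v
  proof -
    have "deriv h v = of_nat q / of_nat p * h v * deriv (\<lambda>v. g v - c) v / (g v - c)"
      using assms h nz that p1 q1 by (intro root_deriv[where S = S]) (auto intro!: holomorphic_intros)
    moreover have "deriv (\<lambda>v. g v - c) v = deriv g v"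
      using assms that holomorphic_on_imp_differentiable_at by (subst deriv_diff) auto
    ultimately show ?thesis by (simp add: inverse_slope_def norm_mult norm_divide)
  qed
  ultimately show ?thesis using h gh by blast
qed

text \<open>The derivative of an inverse branch of order \<open>n\<close> along a disc in
  \<open>W\<close>. Lifting the disc once lands in the preimage of \<open>W\<close>, and there the
  disc can be dilated about its centre by the factor \<open>1 / rate\<close> and still lie in
  \<open>W\<close>. The induction hypothesis applied to the dilated disc gains one factor
  \<open>rate\<close>.\<close>

lemma disc_contraction:
  assumes "g holomorphic_on ball 0 1" "g ` ball 0 1 \<subseteq> W" "backward_orbit f y" "y 0 = g 0"
  shows "norm (deriv g 0) * (\<Prod>i<n. inverse_slope (y i) (y (Suc i))) \<le> 2 * R * rate ^ n"
  using assms
proof (induction n arbitrary: g y)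
  case 0
  \<comment> \<open>Cauchy's estimate on the disc of radius \<open>1/2\<close> avoids any question
    about boundary values and costs the factor \<open>2\<close>.\<close>
  have "norm ((deriv ^^ 1) g 0) \<le> fact 1 * R / (1 / 2) ^ 1"
  proof (rule Cauchy_inequality)
    show "g holomorphic_on ball 0 (1 / 2)" using 0(1) by (rule holomorphic_on_subset) auto
    show "continuous_on (cball 0 (1 / 2)) g"
      by (rule holomorphic_on_imp_continuous_on[OF holomorphic_on_subset[OF 0(1)]]) auto
    fix x :: complex assume "norm (0 - x) = 1 / 2"
    then have "g x \<in> W" using 0(2) by (auto simp: image_subset_iff)
    then show "norm (g x) \<le> R" using W_norm by (simp add: less_imp_le)
  qed simp
  then show ?case by simp
next
  case (Suc n)
  define \<eta> where "\<eta> = margin / (4 * R)"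
  have \<eta>: "\<eta> > 0" using margin(1) Rpos by (simp add: \<eta>_def)
  have rate: "rate = 1 / (1 + \<eta>)" by (simp add: rate_def \<eta>_def)
  have y1: "g 0 \<in> f (y 1)" using Suc.prems(3,4) unfolding backward_orbit_def One_nat_def by metis
  have "\<exists>h. h holomorphic_on ball 0 1 \<and> h 0 = y 1 \<and> (\<forall>v\<in>ball 0 1. g v \<in> f (h v)) \<and>
      h ` ball 0 1 \<subseteq> W \<and> (\<forall>v\<in>ball 0 1. norm (deriv h v) = inverse_slope (g v) (h v) * norm (deriv g v))"
    by (rule preimage_lift[OF open_ball convex_ball Suc.prems(1,2) _ y1]) simp
  then obtain h where h: "h holomorphic_on ball 0 1" "h 0 = y 1" "\<And>v. v \<in> ball 0 1 \<Longrightarrow> g v \<in> f (h v)"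
    "h ` ball 0 1 \<subseteq> W" "norm (deriv h 0) = inverse_slope (g 0) (y 1) * norm (deriv g 0)"
    using centre_in_ball[of 0 1] by (metis (no_types, lifting) zero_less_one)
  define G where "G = (\<lambda>v. y 1 + of_real (1 + \<eta>) * (h v - y 1))"
  \<comment> \<open>The dilation moves points by at most \<open>2 * R * \<eta> = margin /
    2\<close>.\<close>
  have "G v \<in> W" if v: "v \<in> ball 0 1" for v
  proof -
    have hv: "h v \<in> W" using h(4) v by blast
    have h0: "y 1 \<in> W" unfolding h(2)[symmetric] using h(4) by (rule subsetD) simp
    have "G v - h v = of_real \<eta> * (h v - y 1)" by (simp add: G_def algebra_simps)
    then have "dist (h v) (G v) = \<eta> * norm (h v - y 1)"
      using \<eta> by (simp add: dist_norm norm_minus_commute norm_mult)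
    also have "\<dots> \<le> \<eta> * (2 * R)"
      using norm_triangle_ineq4[of "h v" "y 1"] W_norm[OF hv] W_norm[OF h0] \<eta>
      by (intro mult_left_mono) auto
    also have "\<dots> < margin" using margin(1) Rpos by (simp add: \<eta>_def)
    finally have "G v \<in> ball (h v) margin" by simp
    moreover have "g v \<in> Q" using Suc.prems(2) W_subset_Q v by blast
    ultimately show ?thesis using margin(2)[OF _ h(3)[OF v]] by blast
  qed
  then have "G ` ball 0 1 \<subseteq> W" by blast
  have "G holomorphic_on ball 0 1" unfolding G_def by (intro holomorphic_intros h)
  moreover note \<open>G ` ball 0 1 \<subseteq> W\<close>
  moreover have "backward_orbit f (\<lambda>i. y (Suc i))" using Suc.prems(3) by (auto simp: backward_orbit_def)
  moreover have "y (Suc 0) = G 0" by (simp add: G_def h(2))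
  ultimately have IH: "norm (deriv G 0) * (\<Prod>i<n. inverse_slope (y (Suc i)) (y (Suc (Suc i)))) \<le> 2 * R * rate ^ n"
    by (rule Suc.IH)
  have "(h has_field_derivative deriv h 0) (at 0)"
    using h(1) by (intro holomorphic_derivI[where S = "ball 0 1"]) auto
  then have "(G has_field_derivative of_real (1 + \<eta>) * deriv h 0) (at 0)"
    unfolding G_def by (auto intro!: derivative_eq_intros)
  then have "deriv G 0 = of_real (1 + \<eta>) * deriv h 0" by (rule DERIV_imp_deriv)
  then have "norm (deriv G 0) = (1 + \<eta>) * (inverse_slope (g 0) (y 1) * norm (deriv g 0))"
    using \<eta> h(5) by (simp only: norm_mult norm_of_real)
  with IH have "(1 + \<eta>) * (norm (deriv g 0) * (\<Prod>i<Suc n. inverse_slope (y i) (y (Suc i)))) \<le> 2 * R * rate ^ n"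
    unfolding prod.lessThan_Suc_shift using Suc.prems(4) by (simp add: ac_simps)
  then have "norm (deriv g 0) * (\<Prod>i<Suc n. inverse_slope (y i) (y (Suc i))) \<le> 2 * R * rate ^ n / (1 + \<eta>)"
    using \<eta> by (subst pos_le_divide_eq) (auto simp: ac_simps)
  then show ?case by (simp add: rate)
qed

lemma inverse_slope_prod_le:
  assumes "\<rho> > 0" "ball (y 0) \<rho> \<subseteq> W" "backward_orbit f y"
  shows "(\<Prod>i<n. inverse_slope (y i) (y (Suc i))) \<le> 2 * R / \<rho> * rate ^ n"
proof -
  define g where "g = (\<lambda>v. y 0 + of_real \<rho> * v)"
  have "g v \<in> ball (y 0) \<rho>" if "v \<in> ball 0 1" for v
    using that assms(1) by (simp add: g_def dist_norm norm_mult)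
  then have "g ` ball 0 1 \<subseteq> W" using assms(2) by blast
  moreover have "g holomorphic_on ball 0 1" unfolding g_def by (intro holomorphic_intros)
  ultimately have "norm (deriv g 0) * (\<Prod>i<n. inverse_slope (y i) (y (Suc i))) \<le> 2 * R * rate ^ n"
    using assms(3) by (intro disc_contraction) (auto simp: g_def)
  moreover have "(g has_field_derivative of_real \<rho>) (at 0)"
    unfolding g_def by (auto intro!: derivative_eq_intros)
  then have "norm (deriv g 0) = \<rho>" using DERIV_imp_deriv assms(1) by fastforce
  ultimately show ?thesis using assms(1) by (simp add: field_simps)
qed

text \<open>The whole backward orbit is continued holomorphically over a disc; the bound on the
  derivatives of the continued branches gives the estimate for the points.\<close>

lemma backward_shadowing:
  assumes \<delta>: "\<delta> > 0" "ball w (2 * \<delta>) \<subseteq> W" and uv: "u \<in> ball w \<delta>" "v \<in> ball w \<delta>"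
    and y: "backward_orbit f y" "y 0 = u"
  shows "\<exists>y'. backward_orbit f y' \<and> y' 0 = v \<and>
    (\<forall>i. norm (y' i - y i) \<le> 2 * R / \<delta> * rate ^ i * norm (v - u))"
proof -
  define B where "B = ball w \<delta>"
  have BW: "ball v \<delta> \<subseteq> W" if "v \<in> B" for v
  proof -
    have "ball v \<delta> \<subseteq> ball w (2 * \<delta>)"
    proof
      fix s assume "s \<in> ball v \<delta>"
      then show "s \<in> ball w (2 * \<delta>)" using that dist_triangle[of w s v] by (simp add: B_def)
    qed
    then show ?thesis using \<delta>(2) by blast
  qed
  have "v \<in> W" if "v \<in> B" for v using BW[OF that] \<delta>(1) by auto
  define P where "P = (\<lambda>(i::nat) g. g holomorphic_on B \<and> g ` B \<subseteq> W \<and> g u = y i \<and> (i = 0 \<longrightarrow> g = (\<lambda>v. v)))"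
  define T where "T = (\<lambda>(i::nat) g h. (\<forall>v\<in>B. g v \<in> f (h v)) \<and>
    (\<forall>v\<in>B. norm (deriv h v) = inverse_slope (g v) (h v) * norm (deriv g v)))"
  have "\<exists>G. \<forall>i. P i (G i) \<and> T i (G i) (G (Suc i))"
  proof (rule dependent_nat_choice)
    show "\<exists>g. P 0 g" using y(2) \<open>\<And>v. v \<in> B \<Longrightarrow> v \<in> W\<close>
      by (intro exI[of _ "\<lambda>v. v"]) (auto simp: P_def)
    fix g i assume g: "P i g"
    have "g u \<in> f (y (Suc i))" using g y(1) by (simp add: P_def backward_orbit_def)
    then have "\<exists>h. h holomorphic_on B \<and> h u = y (Suc i) \<and> (\<forall>v\<in>B. g v \<in> f (h v)) \<and> h ` B \<subseteq> W \<and>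
        (\<forall>v\<in>B. norm (deriv h v) = inverse_slope (g v) (h v) * norm (deriv g v))"
      using g uv(1) by (intro preimage_lift) (auto simp: P_def B_def)
    then show "\<exists>h. P (Suc i) h \<and> T i g h" by (auto simp: P_def T_def)
  qed
  then obtain G where G: "\<And>i. P i (G i)" "\<And>i. T i (G i) (G (Suc i))" by blast
  have G0: "G 0 = (\<lambda>v. v)" using G(1)[of 0] by (simp add: P_def)
  have hol: "G i holomorphic_on B" for i using G(1) by (simp add: P_def)
  have orb: "backward_orbit f (\<lambda>i. G i s)" if "s \<in> B" for s
    using G(2) that by (simp add: T_def backward_orbit_def)
  have der: "norm (deriv (G i) s) = (\<Prod>j<i. inverse_slope (G j s) (G (Suc j) s))" if "s \<in> B" for i s
  proof (induction i)
    case (Suc i)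
    then show ?case using G(2)[of i] that by (simp add: T_def mult.commute)
  qed (simp add: G0)
  have "norm (G i v - G i u) \<le> 2 * R / \<delta> * rate ^ i * norm (v - u)" for i
  proof (rule field_differentiable_bound[where S = B and f' = "deriv (G i)"])
    show "(G i has_field_derivative deriv (G i) s) (at s within B)" if "s \<in> B" for s
      using holomorphic_derivI[OF hol _ that] by (simp add: B_def has_field_derivative_at_within)
    show "norm (deriv (G i) s) \<le> 2 * R / \<delta> * rate ^ i" if "s \<in> B" for s
      unfolding der[OF that] using inverse_slope_prod_le[OF \<delta>(1) _ orb[OF that]] BW[OF that] by (simp add: G0)
  qed (use uv in \<open>auto simp: B_def\<close>)
  moreover have "G i u = y i" for i using G(1) by (simp add: P_def)
  ultimately show ?thesis using orb[of v] uv(2) by (intro exI[of _ "\<lambda>i. G i v"]) (auto simp: B_def G0)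
qed

section \<open>The repeller\<close>

lemma orbit_escapes:
  assumes "forward_orbit f x" "norm (x i) \<ge> R"
  shows "norm (x (i + k)) \<ge> 2 ^ k * norm (x i)"
proof (induction k)
  case (Suc k)
  have "1 * norm (x i) \<le> 2 ^ k * norm (x i)" by (intro mult_right_mono one_le_power) auto
  then have "norm (x (i + k)) \<ge> R" using Suc assms(2) by linarith
  moreover have "x (Suc (i + k)) \<in> f (x (i + k))" using assms(1) by (simp add: forward_orbit_def)
  ultimately have "norm (x (Suc (i + k))) \<ge> 2 * norm (x (i + k))" by (rule escape)
  then show ?case using Suc by simp
qed simp

lemma cycle_norm_less:
  assumes "is_cycle p q c n x" shows "norm (x i) < R"
proof (rule ccontr)
  assume "\<not> norm (x i) < R"
  then have R: "norm (x i) \<ge> R" by simp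
  have n: "n \<ge> 1" and x: "forward_orbit f x" "x (i + n) = x i" using assms by (auto simp: is_cycle_def)
  have "2 ^ 1 * norm (x i) \<le> 2 ^ n * norm (x i)"
    using n by (intro mult_right_mono power_increasing) auto
  with orbit_escapes[OF x(1) R, of n] x(2) R Rpos show False by simp
qed

lemma norm_less_if_subsequence_converges:
  assumes "forward_orbit f x" "strict_mono s" "(x \<circ> s) \<longlonglongrightarrow> \<zeta>"
  shows "norm (x i) < R"
proof (rule ccontr)
  assume "\<not> norm (x i) < R"
  then have R: "norm (x i) \<ge> R" by simp
  obtain B where B: "\<And>j. norm ((x \<circ> s) j) \<le> B"
    using convergent_imp_bounded[OF assms(3)] by (auto simp: bounded_iff)
  obtain N where N: "B / R < 2 ^ N" using real_arch_pow[of 2 "B / R"] by auto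
  define k where "k = s (i + N) - i"
  have "i + N \<le> s (i + N)" using seq_suble[OF assms(2)] .
  then have k: "s (i + N) = i + k" "N \<le> k" by (auto simp: k_def)
  have "B < 2 ^ N * R" using N Rpos by (simp add: field_simps)
  also have "\<dots> \<le> 2 ^ k * norm (x i)" using k R Rpos by (intro mult_mono power_increasing) auto
  also have "\<dots> \<le> norm (x (i + k))" by (rule orbit_escapes[OF assms(1) R])
  also have "\<dots> \<le> B" using B[of "i + N"] k by simp
  finally show False by simp
qed

lemma backward_orbit_exists: "\<exists>y. backward_orbit f y \<and> y 0 = z"
proof -
  have "\<exists>y. \<forall>n. (n = 0 \<longrightarrow> y n = z) \<and> y n \<in> f (y (Suc n))"
    by (rule dependent_nat_choice) (use corr_preimage[OF p1] in auto)
  then show ?thesis by (auto simp: backward_orbit_def)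
qed

lemma splice_backward:
  assumes x: "\<And>i. i < N \<Longrightarrow> x i \<in> f (x (Suc i))" and t: "backward_orbit f t" "t 0 = x N"
  shows "\<exists>y. backward_orbit f y \<and> (\<forall>i\<le>N. y i = x i) \<and> (\<forall>i. y (N + i) = t i)"
proof -
  define y where "y = (\<lambda>i. if i \<le> N then x i else t (i - N))"
  have "y i \<in> f (y (Suc i))" for i
  proof (cases "i < N")
    case True
    then show ?thesis using x by (simp add: y_def)
  next
    case False
    then have "y i = t (i - N)" "y (Suc i) = t (Suc (i - N))"
      using t(2) by (auto simp: y_def Suc_diff_le)
    then show ?thesis using t(1) by (simp add: backward_orbit_def)
  qed
  moreover have "y (N + i) = t i" for i using t(2) by (simp add: y_def)
  ultimately show ?thesis by (intro exI[of _ y]) (auto simp: backward_orbit_def y_def)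
qed

text \<open>Estimates along backward orbits become estimates along a finite piece of a forward
  orbit, read backwards and then prolonged by arbitrary preimages.\<close>

lemma reverse_orbit:
  assumes "forward_orbit f x"
  shows "\<exists>y. backward_orbit f y \<and> (\<forall>i\<le>N. y i = x (N - i))"
proof -
  obtain t where t: "backward_orbit f t" "t 0 = x (N - N)"
    using backward_orbit_exists[of "x (N - N)"] by blast
  have "x (N - i) \<in> f (x (N - Suc i))" if "i < N" for i
    using assms that unfolding forward_orbit_def by (metis Suc_diff_Suc)
  then show ?thesis using splice_backward[of N "\<lambda>i. x (N - i)" t] t by blast
qed

definition "repeller = {z. \<exists>x. forward_orbit f x \<and> x 0 = z \<and> (\<forall>i. x i \<in> W)}"

text \<open>The points with an orbit of length \<open>m\<close> in \<open>Q\<close>. Compactness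
  of these sets yields compactness of the repeller, which is not evident from its definition by
  infinite orbits in the open set \<open>W\<close>.\<close>

primrec survivors :: "nat \<Rightarrow> complex set" where
  "survivors 0 = Q"
| "survivors (Suc m) = {z \<in> Q. \<exists>w\<in>survivors m. w \<in> f z}"

lemma compact_survivors: "compact (survivors m)"
  by (induction m) (simp_all add: compact_Q compact_preimage)

lemma survivors_subset_Q: "survivors m \<subseteq> Q" by (cases m) auto

lemma survivors_Suc_subset: "survivors (Suc m) \<subseteq> survivors m"
proof (induction m)
  case 0
  then show ?case by auto
next
  case (Suc m)
  show ?case
  proof
    fix z assume "z \<in> survivors (Suc (Suc m))"
    then obtain w where "z \<in> Q" "w \<in> survivors (Suc m)" "w \<in> f z" by (subst (asm) survivors.simps) blast
    then show "z \<in> survivors (Suc m)" using Suc unfolding survivors.simps(2)[of m] by blast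
  qed
qed

lemma survivors_antimono: "m \<le> n \<Longrightarrow> survivors n \<subseteq> survivors m"
  using survivors_Suc_subset by (rule lift_Suc_antimono_le)

text \<open>Koenig's lemma in topological form: the values at \<open>z\<close> that survive for
  \<open>m\<close> steps form a decreasing sequence of nonempty compact sets.\<close>

lemma survivors_step:
  assumes "z \<in> (\<Inter>m. survivors m)"
  shows "\<exists>w. w \<in> f z \<and> w \<in> (\<Inter>m. survivors m)"
proof -
  have "\<Inter> (range (\<lambda>m. survivors m \<inter> f z)) \<noteq> {}"
  proof (rule compact_nest)
    show "compact (survivors m \<inter> f z)" for m
      using compact_survivors finite_corr[OF q1] by (intro compact_Int_closed finite_imp_closed)
    show "survivors m \<inter> f z \<noteq> {}" for m
    proof -
      have "z \<in> survivors (Suc m)" using assms by blast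
      then show ?thesis by auto
    qed
    show "survivors n \<inter> f z \<subseteq> survivors m \<inter> f z" if "m \<le> n" for m n
      using survivors_antimono[OF that] by blast
  qed
  then show ?thesis by blast
qed

lemma repeller_eq: "repeller = (\<Inter>m. survivors m)"
proof (intro set_eqI iffI)
  fix z assume "z \<in> repeller"
  then obtain x where x: "forward_orbit f x" "x 0 = z" "\<And>i. x i \<in> W" by (auto simp: repeller_def)
  have "x i \<in> survivors m" for i m
  proof (induction m arbitrary: i)
    case 0
    then show ?case using x(3) W_subset_Q by auto
  next
    case (Suc m)
    have "x i \<in> Q" "x (Suc i) \<in> f (x i)" using x W_subset_Q by (auto simp: forward_orbit_def)
    then show ?case using Suc[of "Suc i"] unfolding survivors.simps by blast
  qed
  then show "z \<in> (\<Inter>m. survivors m)" using x(2) by blast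
next
  fix z assume z: "z \<in> (\<Inter>m. survivors m)"
  have "\<exists>x. \<forall>n. (x n \<in> (\<Inter>m. survivors m) \<and> (n = 0 \<longrightarrow> x n = z)) \<and> x (Suc n) \<in> f (x n)"
  proof (rule dependent_nat_choice)
    show "\<exists>x. x \<in> (\<Inter>m. survivors m) \<and> (0 = 0 \<longrightarrow> x = z)" using z by blast
    fix x and n :: nat assume "x \<in> (\<Inter>m. survivors m) \<and> (n = 0 \<longrightarrow> x = z)"
    then show "\<exists>y. (y \<in> (\<Inter>m. survivors m) \<and> (Suc n = 0 \<longrightarrow> y = z)) \<and> y \<in> f x"
      using survivors_step[of x] by auto
  qed
  then obtain x where x: "\<And>n. x n \<in> (\<Inter>m. survivors m)" "x 0 = z" "\<And>n. x (Suc n) \<in> f (x n)" by blast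
  have "x n \<in> W" for n
  proof -
    have "x (Suc n) \<in> survivors 0" using x(1) by blast
    then show ?thesis using preimage_of_Q_in_W[OF x(3)] by simp
  qed
  then show "z \<in> repeller" unfolding repeller_def using x(2,3) by (auto simp: forward_orbit_def)
qed

lemma closed_repeller: "closed repeller"
  unfolding repeller_eq using compact_survivors by (intro closed_INT ballI compact_imp_closed)

lemma compact_repeller: "compact repeller"
proof -
  have "repeller \<subseteq> Q" unfolding repeller_eq using survivors_subset_Q by blast
  then have "repeller = Q \<inter> repeller" by blast
  then show ?thesis using compact_Int_closed[OF compact_Q closed_repeller] by simp
qed

lemma repeller_subset_W: "repeller \<subseteq> W" by (auto simp: repeller_def)

lemma repeller_disjoint_E: "repeller \<inter> E = {}" using repeller_subset_W by (auto simp: W_def)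

lemma orbit_in_repeller:
  assumes "forward_orbit f x" "\<And>i. x i \<in> W" shows "x i \<in> repeller"
proof -
  have "forward_orbit f (\<lambda>j. x (i + j))" using assms(1) by (simp add: forward_orbit_def)
  moreover have "(\<lambda>j. x (i + j)) 0 = x i" by simp
  ultimately show ?thesis unfolding repeller_def using assms(2) by blast
qed

lemma backward_orbit_stays_in_W:
  assumes "backward_orbit f y" "y M \<in> W" "M \<le> i" shows "y i \<in> W"
  using assms(3)
proof (induction i rule: dec_induct)
  case (step i)
  have "y i \<in> f (y (Suc i))" using assms(1) by (simp add: backward_orbit_def)
  then show ?case using preimage_of_Q_in_W step.IH W_subset_Q by blast
qed (rule assms(2))

text \<open>A point far along a backward orbit in \<open>W\<close> has a long forward orbit in
  \<open>W\<close>, namely the one it came from.\<close>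

lemma backward_limit_in_repeller:
  assumes "backward_orbit f y" "y M \<in> W" "strict_mono s" "(y \<circ> s) \<longlonglongrightarrow> \<zeta>"
  shows "\<zeta> \<in> repeller"
proof -
  have L: "y (M + i) \<in> survivors i" for i
  proof (induction i)
    case 0
    then show ?case using assms(2) W_subset_Q by auto
  next
    case (Suc i)
    have "y (M + i) \<in> f (y (M + Suc i))" using assms(1) by (simp add: backward_orbit_def)
    moreover have "y (M + Suc i) \<in> Q"
      using backward_orbit_stays_in_W[OF assms(1,2)] W_subset_Q by auto
    ultimately show ?case using Suc unfolding survivors.simps by blast
  qed
  have "\<zeta> \<in> survivors m" for m
  proof (rule closed_sequentially[OF compact_imp_closed[OF compact_survivors]])
    show "(\<lambda>j. (y \<circ> s) (j + (M + m))) \<longlonglongrightarrow> \<zeta>" using assms(4) by (rule LIMSEQ_ignore_initial_segment)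
    show "(y \<circ> s) (j + (M + m)) \<in> survivors m" for j
    proof -
      have "j + (M + m) \<le> s (j + (M + m))" by (rule seq_suble[OF assms(3)])
      then obtain i where i: "s (j + (M + m)) = M + i" "m \<le> i"
        by (metis add.commute add.left_commute add_leD2 le_Suc_ex le_add1 add_le_cancel_left)
      then show ?thesis using L[of i] survivors_antimono[OF i(2)] by auto
    qed
  qed
  then show ?thesis by (simp add: repeller_eq)
qed

lemma forward_inverse_slope_prod_le:
  assumes "\<rho> > 0" "ball (x N) \<rho> \<subseteq> W" "forward_orbit f x"
  shows "(\<Prod>i<N. inverse_slope (x (Suc i)) (x i)) \<le> 2 * R / \<rho> * rate ^ N"
proof -
  obtain y where y: "backward_orbit f y" "\<And>i. i \<le> N \<Longrightarrow> y i = x (N - i)"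
    using reverse_orbit[OF assms(3), of N] by blast
  have "(\<Prod>i<N. inverse_slope (x (Suc i)) (x i)) = (\<Prod>i<N. inverse_slope (x (Suc (N - Suc i))) (x (N - Suc i)))"
    using prod.nat_diff_reindex[of "\<lambda>i. inverse_slope (x (Suc i)) (x i)" N] by simp
  also have "\<dots> = (\<Prod>i<N. inverse_slope (y i) (y (Suc i)))"
    by (intro prod.cong) (auto simp: y(2) Suc_diff_Suc)
  also have "\<dots> \<le> 2 * R / \<rho> * rate ^ N"
    using assms(1,2) y by (intro inverse_slope_prod_le) auto
  finally show ?thesis .
qed

text \<open>Going backwards from a point of \<open>W\<close> one stays in \<open>W\<close>, and on
  a cycle every point is reached by going backwards.\<close>

lemma cycle_in_W:
  assumes "is_cycle p q c n x" "x i \<in> W" shows "x j \<in> W"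
proof -
  have n: "n > 0" and x: "forward_orbit f x" "\<And>i. x (i + n) = x i" using assms(1) by (auto simp: is_cycle_def)
  have per: "x (i + n * k) = x i" for k
  proof (induction k)
    case (Suc k)
    then show ?case using x(2)[of "i + n * k"] by (simp add: ac_simps)
  qed simp
  obtain k where k: "j \<le> i + n * k" using n
    by (metis le_add2 le_trans mult.commute mult_le_mono2 nat_mult_1_right Suc_leI One_nat_def)
  obtain y where y: "backward_orbit f y" "\<And>l. l \<le> i + n * k \<Longrightarrow> y l = x (i + n * k - l)"
    using reverse_orbit[OF x(1), of "i + n * k"] by blast
  have "y 0 \<in> W" using y(2)[of 0] per assms(2) by simp
  then have "y (i + n * k - j) \<in> W" using backward_orbit_stays_in_W[OF y(1)] by blast
  then show ?thesis using y(2)[of "i + n * k - j"] k by simp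
qed

text \<open>The inverse slopes along one period multiply to \<open>S = 1 / norm l\<close>. Their
  product over \<open>m\<close> periods is \<open>S ^ m\<close>, and exponential contraction of
  inverse branches makes it tend to \<open>0\<close>.\<close>

lemma cycle_in_W_repelling:
  assumes cyc: "is_cycle p q c n x" and W: "x i \<in> W"
  shows "repelling_cycle p q c n x"
proof -
  have n: "n > 0" and x: "forward_orbit f x" "\<And>i. x (i + n) = x i" using cyc by (auto simp: is_cycle_def)
  have xW: "x j \<in> W" for j using cycle_in_W[OF assms] .
  have xc: "x j \<noteq> c" for j using xW[of j] c_notin_W by auto
  have nz: "x j \<noteq> 0" for j
  proof
    assume "x j = 0"
    then have "x (Suc j) = c" using x(1) corr_zero[OF p1 q1, of c] unfolding forward_orbit_def
      by (metis singletonD)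
    then show False using xc by blast
  qed
  then have r0: "0 \<notin> range x" by (metis rangeE)
  define S where "S = (\<Prod>i<n. inverse_slope (x (Suc i)) (x i))"
  have split: "(\<Prod>i<a + k. g i) = (\<Prod>i<a. g i) * (\<Prod>i<k. g (a + i))" for g :: "nat \<Rightarrow> real" and a k
    by (induction k) (simp_all add: mult.assoc)
  have S: "(\<Prod>i<n * m. inverse_slope (x (Suc i)) (x i)) = S ^ m" for m
  proof (induction m)
    case (Suc m)
    have per: "x (n * m + i) = x i" for i
    proof (induction m)
      case (Suc m)
      then show ?case using x(2)[of "n * m + i"] by (simp add: ac_simps)
    qed simp
    have "(\<Prod>i<n * m + n. inverse_slope (x (Suc i)) (x i)) =
        (\<Prod>i<n * m. inverse_slope (x (Suc i)) (x i)) * (\<Prod>i<n. inverse_slope (x (Suc (n * m + i))) (x (n * m + i)))"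
      using split[of "\<lambda>i. inverse_slope (x (Suc i)) (x i)" "n * m" n] by simp
    also have "(\<Prod>i<n. inverse_slope (x (Suc (n * m + i))) (x (n * m + i))) = S"
      unfolding S_def using per per[of "Suc _"] by simp
    finally show ?case using Suc by (simp add: ac_simps)
  qed simp
  obtain \<rho> where \<rho>: "\<rho> > 0" "ball (x 0) \<rho> \<subseteq> W"
    using open_W xW[of 0] by (metis openE)
  have Sle: "S ^ m \<le> 2 * R / \<rho> * (rate ^ n) ^ m" for m
  proof -
    have "x (n * m) = x 0"
    proof (induction m)
      case (Suc m)
      then show ?case using x(2)[of "n * m"] by (simp add: ac_simps)
    qed simp
    then show ?thesis
      using forward_inverse_slope_prod_le[of \<rho> x "n * m"] \<rho> x(1) by (simp add: S power_mult)
  qed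
  have "S < 1"
  proof (rule ccontr)
    assume "\<not> S < 1"
    then have "1 \<le> S ^ m" for m by (simp add: one_le_power)
    moreover have "(\<lambda>m. 2 * R / \<rho> * (rate ^ n) ^ m) \<longlonglongrightarrow> 2 * R / \<rho> * 0"
      using rate n by (intro tendsto_mult tendsto_const LIMSEQ_realpow_zero) (auto simp: power_less_one_iff)
    ultimately have "1 \<le> 2 * R / \<rho> * 0"
      using Sle by (intro LIMSEQ_le_const) (auto intro: order_trans)
    then show False by simp
  qed
  define l where "l = (\<Prod>i<n. of_nat p / of_nat q * (x (Suc i) - c) / x i)"
  have "norm l * S = (\<Prod>i<n. norm (of_nat p / of_nat q * (x (Suc i) - c) / x i) * inverse_slope (x (Suc i)) (x i))"
    by (simp only: l_def S_def prod_norm prod.distrib)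
  also have "\<dots> = (\<Prod>i<n. 1)"
  proof (intro prod.cong refl)
    fix i
    define a b where "a = norm (x (Suc i) - c)" and "b = norm (x i)"
    have "a > 0" "b > 0" using nz xc by (auto simp: a_def b_def)
    moreover have "norm (of_nat p / of_nat q * (x (Suc i) - c) / x i) = real p / real q * a / b"
      by (simp add: norm_mult norm_divide a_def b_def)
    ultimately show "norm (of_nat p / of_nat q * (x (Suc i) - c) / x i) * inverse_slope (x (Suc i)) (x i) = 1"
      using p1 q1 by (simp add: inverse_slope_def flip: a_def b_def)
  qed
  finally have "norm l * S = 1" by simp
  moreover have "S \<ge> 0" unfolding S_def by (intro prod_nonneg) (simp add: inverse_slope_nonneg)
  ultimately have "norm l > 1" using \<open>S < 1\<close>
    by (smt (verit) mult_left_le norm_ge_zero mult_cancel_left1)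
  moreover have "is_multiplier p q c n x l"
    using is_multiplier_iff[OF q1 p1 cyc r0] by (simp add: l_def)
  ultimately show ?thesis using cyc r0 by (auto simp: repelling_cycle_def)
qed

text \<open>The constant \<open>C\<close> depends on the two points but not on the orbit. This
  makes the relation transitive, and connectedness can be used to pass from a local to a global
  statement.\<close>

definition "shadowed u v \<longleftrightarrow> (\<exists>C. \<forall>y. backward_orbit f y \<longrightarrow> y 0 = u \<longrightarrow>
   (\<exists>y'. backward_orbit f y' \<and> y' 0 = v \<and> (\<forall>i. norm (y' i - y i) \<le> C * rate ^ i)))"

lemma shadowed_trans:
  assumes "shadowed u v" "shadowed v w" shows "shadowed u w"
proof -
  obtain C where C: "\<And>y. backward_orbit f y \<Longrightarrow> y 0 = u \<Longrightarrow>
     \<exists>y'. backward_orbit f y' \<and> y' 0 = v \<and> (\<forall>i. norm (y' i - y i) \<le> C * rate ^ i)"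
    using assms(1) unfolding shadowed_def by blast
  obtain D where D: "\<And>y. backward_orbit f y \<Longrightarrow> y 0 = v \<Longrightarrow>
     \<exists>y'. backward_orbit f y' \<and> y' 0 = w \<and> (\<forall>i. norm (y' i - y i) \<le> D * rate ^ i)"
    using assms(2) unfolding shadowed_def by blast
  have "\<exists>y''. backward_orbit f y'' \<and> y'' 0 = w \<and> (\<forall>i. norm (y'' i - y i) \<le> (C + D) * rate ^ i)"
    if y: "backward_orbit f y" "y 0 = u" for y
  proof -
    obtain y' where y': "backward_orbit f y'" "y' 0 = v" "\<And>i. norm (y' i - y i) \<le> C * rate ^ i"
      using C[OF y] by blast
    obtain y'' where y'': "backward_orbit f y''" "y'' 0 = w" "\<And>i. norm (y'' i - y' i) \<le> D * rate ^ i"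
      using D[OF y'(1,2)] by blast
    have "norm (y'' i - y i) \<le> (C + D) * rate ^ i" for i
      using norm_triangle_ineq[of "y'' i - y' i" "y' i - y i"] y'(3)[of i] y''(3)[of i]
      by (simp add: distrib_right)
    then show ?thesis using y'' by blast
  qed
  then show ?thesis unfolding shadowed_def by blast
qed

lemma shadowed_locally:
  assumes "\<delta> > 0" "ball w (2 * \<delta>) \<subseteq> W" "u \<in> ball w \<delta>" "v \<in> ball w \<delta>"
  shows "shadowed u v"
proof -
  have "2 * R / \<delta> * rate ^ i * norm (v - u) = (2 * R / \<delta> * norm (v - u)) * rate ^ i" for i
    by simp
  then show ?thesis unfolding shadowed_def using backward_shadowing[OF assms] by metis
qed

lemma double_ball_in_W:
  assumes "w \<in> W" obtains \<delta> where "\<delta> > 0" "ball w (2 * \<delta>) \<subseteq> W"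
proof -
  obtain e where "e > 0" "ball w e \<subseteq> W" using open_W assms by (metis openE)
  then show ?thesis using that[of "e / 2"] by simp
qed

lemma shadowed_in_W:
  assumes "u \<in> W" "v \<in> W" shows "shadowed u v"
proof -
  have "shadowed u v \<and> shadowed v u"
  proof (rule connected_equivalence_relation[OF connected_W assms])
    fix w assume "w \<in> W"
    then obtain \<delta> where \<delta>: "\<delta> > 0" "ball w (2 * \<delta>) \<subseteq> W" by (rule double_ball_in_W)
    have "ball w \<delta> \<subseteq> W" using \<delta> by (intro order_trans[OF _ \<delta>(2)] subset_ball) auto
    then have "openin (top_of_set W) (ball w \<delta>)" by (intro open_subset) auto
    moreover have "\<forall>v\<in>ball w \<delta>. shadowed w v \<and> shadowed v w"
      using shadowed_locally[OF \<delta>] \<delta>(1) by auto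
    ultimately show "\<exists>T. openin (top_of_set W) T \<and> w \<in> T \<and> (\<forall>v\<in>T. shadowed w v \<and> shadowed v w)"
      using \<delta>(1) by (intro exI[of _ "ball w \<delta>"]) auto
  qed (use shadowed_trans in blast)+
  then show ?thesis by blast
qed

text \<open>Let \<open>x\<close> be an orbit of \<open>\<zeta>\<close> in the repeller, with an
  accumulation point \<open>\<xi>\<close>. For \<open>x n\<close> close to \<open>\<xi>\<close>,
  the backward orbit from \<open>x n\<close> to \<open>\<zeta>\<close> is shadowed first from
  \<open>\<xi>\<close>, with a constant independent of \<open>n\<close>, and then from
  \<open>z\<close>.\<close>

lemma backward_orbit_approaches_repeller:
  assumes z: "z \<in> W" and \<zeta>: "\<zeta> \<in> repeller" and \<epsilon>: "\<epsilon> > 0"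
  shows "\<exists>y n. backward_orbit f y \<and> y 0 = z \<and> n \<ge> N \<and> norm (y n - \<zeta>) < \<epsilon>"
proof -
  obtain x where x: "forward_orbit f x" "x 0 = \<zeta>" "\<And>i. x i \<in> W" using \<zeta> by (auto simp: repeller_def)
  have "\<forall>i. x i \<in> repeller" using orbit_in_repeller[OF x(1,3)] by blast
  then obtain \<xi> s where s: "\<xi> \<in> repeller" "strict_mono s" "(x \<circ> s) \<longlonglongrightarrow> \<xi>"
    using compact_repeller unfolding compact_def by blast
  obtain \<delta> where \<delta>: "\<delta> > 0" "ball \<xi> (2 * \<delta>) \<subseteq> W"
    using double_ball_in_W[of \<xi>] s(1) repeller_subset_W by blast
  obtain C where C: "\<And>y. backward_orbit f y \<Longrightarrow> y 0 = \<xi> \<Longrightarrow>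
     \<exists>y'. backward_orbit f y' \<and> y' 0 = z \<and> (\<forall>i. norm (y' i - y i) \<le> C * rate ^ i)"
    using shadowed_in_W[of \<xi> z] s(1) repeller_subset_W z unfolding shadowed_def by blast
  define D where "D = C + 2 * R"
  have "(\<lambda>n. D * rate ^ n) \<longlonglongrightarrow> D * 0"
    using rate by (intro tendsto_mult tendsto_const LIMSEQ_realpow_zero) auto
  then have "\<forall>\<^sub>F n in sequentially. D * rate ^ n < \<epsilon>" using \<epsilon> by (intro order_tendstoD) auto
  then obtain N1 where N1: "\<And>n. n \<ge> N1 \<Longrightarrow> D * rate ^ n < \<epsilon>" by (auto simp: eventually_sequentially)
  have "\<forall>\<^sub>F j in sequentially. dist ((x \<circ> s) j) \<xi> < \<delta>" using s(3) \<delta>(1) by (rule tendstoD)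
  then obtain N2 where N2: "\<And>j. j \<ge> N2 \<Longrightarrow> dist ((x \<circ> s) j) \<xi> < \<delta>" by (auto simp: eventually_sequentially)
  define j where "j = N + N1 + N2"
  define n where "n = s j"
  have n: "n \<ge> N" "n \<ge> N1" using seq_suble[OF s(2), of j] by (auto simp: n_def j_def)
  have xn: "x n \<in> ball \<xi> \<delta>" using N2[of j] by (simp add: n_def j_def dist_commute)
  obtain y where y: "backward_orbit f y" "\<And>i. i \<le> n \<Longrightarrow> y i = x (n - i)"
    using reverse_orbit[OF x(1), of n] by blast
  obtain y' where y': "backward_orbit f y'" "y' 0 = \<xi>"
    "\<And>i. norm (y' i - y i) \<le> 2 * R / \<delta> * rate ^ i * norm (\<xi> - x n)"
    using backward_shadowing[OF \<delta> xn _ y(1), of \<xi>] \<delta>(1) y(2)[of 0] by auto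
  obtain y'' where y'': "backward_orbit f y''" "y'' 0 = z" "\<And>i. norm (y'' i - y' i) \<le> C * rate ^ i"
    using C[OF y'(1,2)] by blast
  have "norm (y' n - y n) \<le> 2 * R / \<delta> * rate ^ n * \<delta>"
    using y'(3)[of n] xn rate Rpos \<delta>(1)
    by (intro order_trans[OF y'(3)] mult_left_mono) (auto simp: dist_norm)
  also have "\<dots> = 2 * R * rate ^ n" using \<delta>(1) by simp
  finally have "norm (y'' n - \<zeta>) \<le> D * rate ^ n"
    using norm_triangle_ineq[of "y'' n - y' n" "y' n - y n"] y''(3)[of n] y(2)[of n] x(2)
    by (simp add: D_def distrib_right)
  then have "norm (y'' n - \<zeta>) < \<epsilon>" using N1[OF n(2)] by simp
  then show ?thesis using y'' n(1) by blast
qed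

text \<open>Stepping by \<open>n - 1\<close> is stepping by \<open>-1\<close> modulo the period,
  so it reverses the orbit.\<close>

lemma backward_periodic_to_cycle:
  assumes "backward_orbit f y" "\<And>i. y (i + n) = y i" "n \<ge> 1"
  shows "is_cycle p q c n (\<lambda>i. y (i * (n - 1)))"
proof -
  have "y (Suc i * (n - 1)) \<in> f (y (i * (n - 1)))" for i
  proof -
    have "Suc (Suc i * (n - 1)) = i * (n - 1) + n" using assms(3) by simp
    then show ?thesis using assms(1,2) unfolding backward_orbit_def by metis
  qed
  moreover have "y ((i + n) * (n - 1)) = y (i * (n - 1))" for i
  proof -
    have "y (k + n * m) = y k" for k m
    proof (induction m)
      case (Suc m)
      then show ?case using assms(2)[of "k + n * m"] by (simp add: ac_simps)
    qed simp
    then show ?thesis by (simp add: distrib_right)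
  qed
  ultimately show ?thesis using assms(3) by (simp add: is_cycle_def forward_orbit_def)
qed

text \<open>By the previous approximation \<open>\<zeta>\<close> has a preimage of high order
  \<open>n\<close> close to itself, and the inverse correspondence contracts nearby orbits: the
  closing lemma applies to the inverse correspondence.\<close>

lemma repelling_cycle_near_repeller:
  assumes \<zeta>: "\<zeta> \<in> repeller" and \<epsilon>: "\<epsilon> > 0"
  shows "\<exists>n x. repelling_cycle p q c n x \<and> norm (x 0 - \<zeta>) < \<epsilon>"
proof -
  have \<zeta>W: "\<zeta> \<in> W" using \<zeta> repeller_subset_W by blast
  obtain \<delta> where \<delta>: "\<delta> > 0" "ball \<zeta> (2 * \<delta>) \<subseteq> W" using double_ball_in_W[OF \<zeta>W] .
  \<comment> \<open>The shadowing constant \<open>2 * R / \<delta>\<close> may exceed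
    \<open>1\<close>, but at the starting point the distance is not increased.\<close>
  define e where "e = (\<lambda>i. if i = 0 then 1 else 2 * R / \<delta> * rate ^ i)"
  define \<eta> where "\<eta> = min (\<delta> / 4) (\<epsilon> / 4)"
  have \<eta>: "\<eta> > 0" "\<eta> \<le> \<delta> / 4" "\<eta> \<le> \<epsilon> / 4" using \<delta> \<epsilon> by (auto simp: \<eta>_def)
  have epos: "0 \<le> e i" for i using rate Rpos \<delta>(1) by (simp add: e_def)
  have "(\<lambda>n. 2 * R / \<delta> * rate ^ n) \<longlonglongrightarrow> 2 * R / \<delta> * 0"
    using rate by (intro tendsto_mult tendsto_const LIMSEQ_realpow_zero) auto
  then have "\<forall>\<^sub>F n in sequentially. 2 * R / \<delta> * rate ^ n < 1 / 2" by (intro order_tendstoD) auto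
  then obtain N where N: "\<And>n. n \<ge> N \<Longrightarrow> 2 * R / \<delta> * rate ^ n < 1 / 2" by (auto simp: eventually_sequentially)
  obtain x n where x: "backward_orbit f x" "x 0 = \<zeta>" "n \<ge> N + 1" "norm (x n - \<zeta>) < \<eta>"
    using backward_orbit_approaches_repeller[OF \<zeta>W \<zeta> \<eta>(1)] by blast
  have n: "n \<ge> 1" using x(3) by simp
  define F where "F = (\<lambda>w. {z. w \<in> f z})"
  have FB: "forward_orbit F y \<longleftrightarrow> backward_orbit f y" for y
    by (simp add: F_def forward_orbit_def backward_orbit_def)
  have "\<exists>y. forward_orbit F y \<and> (\<forall>i. y (i + n) = y i) \<and> (\<forall>i\<le>n. norm (y i - x i) \<le> 2 * \<eta> * e i)"
  proof (rule closing_lemma)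
    show "b \<in> F a" if "X \<longlonglongrightarrow> a" "Y \<longlonglongrightarrow> b" "\<And>m. Y m \<in> F (X m)" for X Y a b
      using corr_limit[of Y b X a] that by (simp add: F_def)
    show "n \<ge> 1" "e 0 = 1" "\<And>i. i \<le> n \<Longrightarrow> 0 \<le> e i" using n epos by (auto simp: e_def)
    show "e n \<le> 1 / 2" using N[of n] x(3) by (simp add: e_def)
    show "forward_orbit F x" using x(1) by (simp add: FB)
    show "norm (x n - x 0) \<le> \<eta>" using x by simp
    fix y v assume y: "forward_orbit F y" and cl: "\<And>i. i \<le> n \<Longrightarrow> norm (y i - x i) \<le> 2 * \<eta> * e i"
      and v: "norm (v - y 0) \<le> \<eta>"
    have y0: "norm (y 0 - \<zeta>) \<le> 2 * \<eta>" using cl[of 0] x(2) by (simp add: e_def)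
    then have "y 0 \<in> ball \<zeta> \<delta>" using \<eta> \<delta>(1) by (simp add: dist_norm norm_minus_commute)
    moreover have "v \<in> ball \<zeta> \<delta>"
      using norm_triangle_ineq[of "v - y 0" "y 0 - \<zeta>"] y0 v \<eta> \<delta>(1)
      by (simp add: dist_norm norm_minus_commute)
    ultimately obtain y' where y': "backward_orbit f y'" "y' 0 = v"
      "\<And>i. norm (y' i - y i) \<le> 2 * R / \<delta> * rate ^ i * norm (v - y 0)"
      using backward_shadowing[OF \<delta>, of "y 0" v y] y by (auto simp: FB)
    have "norm (y' i - y i) \<le> e i * norm (v - y 0)" for i
      using y'(2) y'(3)[of i] by (cases "i = 0") (auto simp: e_def)
    then show "\<exists>y'. forward_orbit F y' \<and> y' 0 = v \<and> (\<forall>i\<le>n. norm (y' i - y i) \<le> e i * norm (v - y 0))"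
      using y' by (auto simp: FB)
  qed
  then obtain y where y: "backward_orbit f y" "\<And>i. y (i + n) = y i" "norm (y 0 - \<zeta>) \<le> 2 * \<eta>"
    using x(2) by (auto simp: FB e_def)
  have "y 0 \<in> ball \<zeta> (2 * \<delta>)" using y(3) \<eta> \<delta>(1) by (simp add: dist_norm norm_minus_commute)
  then have "y 0 \<in> W" using \<delta>(2) by blast
  then have "repelling_cycle p q c n (\<lambda>i. y (i * (n - 1)))"
    by (intro cycle_in_W_repelling[of _ _ 0] backward_periodic_to_cycle) (use y n in auto)
  moreover have "norm (y (0 * (n - 1)) - \<zeta>) < \<epsilon>" using y(3) \<eta> \<epsilon> by simp
  ultimately show ?thesis by blast
qed

section \<open>Dynamics inside the discs\<close>

text \<open>An orbit in \<open>E\<close> determines its sequence of discs since the discs are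
  disjoint; the contraction inequality of the trap then holds along the sequence.\<close>

lemma labels_exist:
  assumes "\<And>i. i \<le> n \<Longrightarrow> x i \<in> E" "\<And>i. i < n \<Longrightarrow> x (Suc i) \<in> f (x i)"
  shows "\<exists>a. (\<forall>i\<le>n. a i \<in> A \<and> x i \<in> cball (a i) (r (a i))) \<and>
    (\<forall>i<n. 2 * (lip p q (norm (a i) + 3 * r (a i)) * r (a i)) \<le> r (a (Suc i)))"
proof -
  have "\<forall>i. \<exists>a. i \<le> n \<longrightarrow> a \<in> A \<and> x i \<in> cball a (r a)"
    using assms(1) unfolding E_def by blast
  then obtain a where a: "\<And>i. i \<le> n \<Longrightarrow> a i \<in> A" "\<And>i. i \<le> n \<Longrightarrow> x i \<in> cball (a i) (r (a i))" by metis
  have "2 * (lip p q (norm (a i) + 3 * r (a i)) * r (a i)) \<le> r (a (Suc i))" if i: "i < n" for i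
  proof -
    have S: "Suc i \<le> n" "i \<le> n" using i by auto
    have "norm (x (Suc i)) \<le> R"
      using subsetD[OF inside[OF a(1)[OF S(1)]] a(2)[OF S(1)]] by simp
    then obtain b where b: "b \<in> A" "x (Suc i) \<in> ball b (r b)"
        "2 * (lip p q (norm (a i) + 3 * r (a i)) * r (a i)) \<le> r b"
      using step[OF a(1)[OF S(2)] a(2)[OF S(2)] assms(2)[OF i]] by blast
    have "b = a (Suc i)"
      using disj[OF b(1) a(1)[OF S(1)]] a(2)[OF S(1)] subsetD[OF ball_subset_cball b(2)] by blast
    then show ?thesis using b(3) by simp
  qed
  then show ?thesis using a by blast
qed

lemma label_unique:
  assumes "a \<in> A" "b \<in> A" "z \<in> cball a (r a)" "z \<in> cball b (r b)" shows "a = b"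
  using disj[OF assms(1,2)] assms(3,4) by blast

text \<open>Contraction in units of the radii. The hypotheses on \<open>s\<close> and
  \<open>t\<close> keep both orbits within three radii of the centres, where the trap controls the
  Lipschitz constant.\<close>

lemma forward_shadowing:
  assumes a: "\<And>i. i \<le> n \<Longrightarrow> a i \<in> A"
      "\<And>i. i < n \<Longrightarrow> 2 * (lip p q (norm (a i) + 3 * r (a i)) * r (a i)) \<le> r (a (Suc i))"
    and y: "\<And>i. i < n \<Longrightarrow> y (Suc i) \<in> f (y i)" "\<And>i. i \<le> n \<Longrightarrow> norm (y i - a i) \<le> t * r (a i)"
    and v: "norm (v - y 0) \<le> s * r (a 0)" and ts: "0 \<le> s" "t + s \<le> 3"
  shows "\<exists>y'. forward_orbit f y' \<and> y' 0 = v \<and>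
    (\<forall>i\<le>n. norm (y' i - y i) \<le> (1 / 2) ^ i * (r (a i) / r (a 0)) * norm (v - y 0))"
proof -
  define D where "D = norm (v - y 0) / r (a 0)"
  have r0: "r (a 0) > 0" using rpos a(1) by simp
  have D: "0 \<le> D" "D \<le> s" using v r0 by (auto simp: D_def field_simps)
  have "\<exists>y'. \<forall>i. ((i = 0 \<longrightarrow> y' i = v) \<and> (i \<le> n \<longrightarrow> norm (y' i - y i) \<le> (1 / 2) ^ i * r (a i) * D)) \<and>
      y' (Suc i) \<in> f (y' i)"
  proof (rule dependent_nat_choice)
    show "\<exists>u. (0 = 0 \<longrightarrow> u = v) \<and> (0 \<le> n \<longrightarrow> norm (u - y 0) \<le> (1 / 2) ^ 0 * r (a 0) * D)"
      using r0 by (intro exI[of _ v]) (simp add: D_def)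
    fix u i assume u: "(i = 0 \<longrightarrow> u = v) \<and> (i \<le> n \<longrightarrow> norm (u - y i) \<le> (1 / 2) ^ i * r (a i) * D)"
    show "\<exists>u'. ((Suc i = 0 \<longrightarrow> u' = v) \<and> (Suc i \<le> n \<longrightarrow> norm (u' - y (Suc i)) \<le> (1 / 2) ^ Suc i * r (a (Suc i)) * D)) \<and> u' \<in> f u"
    proof (cases "i < n")
      case True
      define T where "T = norm (a i) + 3 * r (a i)"
      have ri: "r (a i) > 0" using rpos a(1) True by simp
      have ud: "norm (u - y i) \<le> (1 / 2) ^ i * r (a i) * D" using u True by simp
      have "(1 / 2) ^ i * r (a i) * D \<le> 1 * r (a i) * s"
        using ri D by (intro mult_mono power_le_one) auto
      then have us: "norm (u - y i) \<le> s * r (a i)" using ud by (simp add: mult.commute)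
      have yi: "norm (y i - a i) \<le> t * r (a i)" using y(2) True by simp
      have tsr: "t * r (a i) + s * r (a i) \<le> 3 * r (a i)"
        using ri ts(2) by (simp flip: distrib_right)
      have sr: "0 \<le> s * r (a i)" using ts(1) ri by simp
      have "norm (y i) \<le> norm (a i) + norm (y i - a i)" by (metis norm_triangle_sub)
      then have 1: "norm (y i) \<le> T" using yi tsr sr unfolding T_def by linarith
      have "norm u \<le> norm (y i) + norm (u - y i)" by (metis norm_triangle_sub)
      then have 2: "norm u \<le> T"
        using yi us tsr \<open>norm (y i) \<le> norm (a i) + norm (y i - a i)\<close> unfolding T_def by linarith
      obtain u' where u': "u' \<in> f u" "norm (u' - y (Suc i)) \<le> lip p q T * norm (u - y i)"
        using corr_lipschitz[OF q1 pq 1 2 y(1)[OF True]] by blast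
      have "lip p q T * norm (u - y i) \<le> lip p q T * ((1 / 2) ^ i * r (a i) * D)"
        using ud lip_nonneg by (intro mult_left_mono)
      also have "\<dots> = (1 / 2) ^ i * D * (lip p q T * r (a i))" by (simp add: ac_simps)
      also have "\<dots> \<le> (1 / 2) ^ i * D * (r (a (Suc i)) / 2)"
        using a(2)[OF True] D by (intro mult_left_mono) (auto simp: T_def)
      also have "\<dots> = (1 / 2) ^ Suc i * r (a (Suc i)) * D" by simp
      finally show ?thesis using u' by (intro exI[of _ u']) auto
    next
      case False
      then show ?thesis using corr_nonempty[OF q1] by auto
    qed
  qed
  then obtain y' where y': "\<And>i. y' (Suc i) \<in> f (y' i)" "y' 0 = v"
    "\<And>i. i \<le> n \<Longrightarrow> norm (y' i - y i) \<le> (1 / 2) ^ i * r (a i) * D" by blast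
  have "norm (y' i - y i) \<le> (1 / 2) ^ i * (r (a i) / r (a 0)) * norm (v - y 0)" if "i \<le> n" for i
    using y'(3)[OF that] by (simp add: D_def)
  then show ?thesis using y' by (intro exI[of _ y']) (auto simp: forward_orbit_def)
qed

text \<open>The bounds on the derivatives telescope along the cycle of discs, leaving \<open>(1/2)
  ^ n\<close>.\<close>

lemma multiplier_small:
  assumes cyc: "is_cycle p q c n x" and nz: "0 \<notin> range x" and l: "is_multiplier p q c n x l"
    and a: "\<And>i. i \<le> n \<Longrightarrow> a i \<in> A"
      "\<And>i. i < n \<Longrightarrow> 2 * (lip p q (norm (a i) + 3 * r (a i)) * r (a i)) \<le> r (a (Suc i))"
      "a n = a 0"
    and near: "\<And>i. i < n \<Longrightarrow> norm (x i - a i) \<le> 3 * r (a i)"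
  shows "norm l < 1"
proof -
  have x: "n > 0" "\<And>i. x (Suc i) \<in> f (x i)" using cyc by (auto simp: is_cycle_def forward_orbit_def)
  have x0: "x i \<noteq> 0" for i using nz by (metis rangeI)
  have le: "norm (of_nat p / of_nat q * (x (Suc i) - c) / x i) \<le> 1 / 2 * (r (a (Suc i)) / r (a i))"
    if "i < n" for i
  proof -
    have ri: "r (a i) > 0" using rpos a(1) that by simp
    have "norm (of_nat p / of_nat q * (x (Suc i) - c) / x i) = lip p q (norm (x i))"
      using corr_norm[OF q1 p1 x(2)] x0[of i]
      by (simp add: norm_mult norm_divide lip_def powr_diff)
    also have "\<dots> \<le> lip p q (norm (a i) + 3 * r (a i))"
      using near[OF that] norm_triangle_sub[of "x i" "a i"] by (intro lip_mono q1 pq) auto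
    also have "\<dots> \<le> 1 / 2 * (r (a (Suc i)) / r (a i))"
      using a(2)[OF that] ri by (simp add: field_simps)
    finally show ?thesis .
  qed
  have "norm l = (\<Prod>i<n. norm (of_nat p / of_nat q * (x (Suc i) - c) / x i))"
    using l is_multiplier_iff[OF q1 p1 cyc nz] by (simp only: prod_norm)
  also have "\<dots> \<le> (\<Prod>i<n. 1 / 2 * (r (a (Suc i)) / r (a i)))"
    using le by (intro prod_mono) auto
  also have "\<dots> = (1 / 2) ^ n * (r (a n) / r (a 0))"
  proof -
    have "m \<le> n \<Longrightarrow> (\<Prod>i<m. 1 / 2 * (r (a (Suc i)) / r (a i))) = (1 / 2) ^ m * (r (a m) / r (a 0))" for m
    proof (induction m)
      case 0
      have "r (a 0) \<noteq> 0" using rpos[of "a 0"] a(1)[of 0] by simp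
      then show ?case by simp
    next
      case (Suc m)
      have "r (a m) \<noteq> 0" using rpos[of "a m"] a(1)[of m] Suc.prems by simp
      then show ?case using Suc by simp
    qed
    then show ?thesis by simp
  qed
  also have "\<dots> = (1 / 2) ^ n"
    using a(3) rpos[of "a 0"] a(1)[of 0] by simp
  also have "\<dots> < 1" using x(1) by (simp add: power_less_one_iff)
  finally show ?thesis .
qed

lemma orbit_stays_in_E:
  assumes "\<And>i. x (Suc i) \<in> f (x i)" "\<And>i. norm (x i) \<le> R" "x M \<in> E" "M \<le> i"
  shows "x i \<in> E"
  using assms(4)
proof (induction i rule: dec_induct)
  case (step i)
  then show ?case using E_forward assms(1,2) by blast
qed (rule assms(3))

lemma cycle_in_W_or_E:
  assumes "is_cycle p q c n x" shows "range x \<subseteq> W \<or> range x \<subseteq> E"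
proof (cases "range x \<subseteq> W")
  case False
  have n: "n > 0" and x: "\<And>i. x (Suc i) \<in> f (x i)" "\<And>i. x (i + n) = x i"
    using assms by (auto simp: is_cycle_def forward_orbit_def)
  have R: "norm (x i) \<le> R" for i using cycle_norm_less[OF assms] by (simp add: less_imp_le)
  obtain M where M: "x M \<in> E"
    using False cycle_norm_less[OF assms] by (auto simp: W_def)
  have "x j \<in> E" for j
  proof -
    have "x (j + n * m) = x j" for m
    proof (induction m)
      case (Suc m)
      then show ?case using x(2)[of "j + n * m"] by (simp add: ac_simps)
    qed simp
    moreover have "x (j + n * M) \<in> E"
    proof (rule orbit_stays_in_E[of x M])
      show "M \<le> j + n * M" using n by (simp add: trans_le_add2)
    qed (use x(1) R M in auto)
    ultimately show ?thesis by simp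
  qed
  then show ?thesis by blast
qed simp

lemma attracting_cycle_in_E:
  assumes "attracting_cycle p q c n x" shows "range x \<subseteq> E"
proof (rule ccontr)
  have cyc: "is_cycle p q c n x" using assms by (simp add: attracting_cycle_def)
  assume "\<not> range x \<subseteq> E"
  then have "x 0 \<in> W" using cycle_in_W_or_E[OF cyc] by blast
  then have "repelling_cycle p q c n x" using cycle_in_W_repelling[OF cyc] by blast
  then obtain l where l: "0 \<notin> range x" "is_multiplier p q c n x l" "norm l > 1"
    by (auto simp: repelling_cycle_def)
  obtain l' where l': "is_multiplier p q c n x l'" "norm l' < 1"
    using assms l(1) by (auto simp: attracting_cycle_def)
  have "l = l'" using is_multiplier_iff[OF q1 p1 cyc l(1)] l(2) l'(1) by simp
  then show False using l(3) l'(2) by simp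
qed

lemma repelling_cycle_in_W:
  assumes "repelling_cycle p q c n x" shows "range x \<subseteq> W"
proof (rule ccontr)
  have cyc: "is_cycle p q c n x" using assms by (simp add: repelling_cycle_def)
  assume "\<not> range x \<subseteq> W"
  then have E: "x i \<in> E" for i using cycle_in_W_or_E[OF cyc] by blast
  have x: "\<And>i. x (Suc i) \<in> f (x i)" "x (0 + n) = x 0"
    using cyc unfolding is_cycle_def forward_orbit_def by blast+
  obtain l where l: "0 \<notin> range x" "is_multiplier p q c n x l" "norm l > 1"
    using assms by (auto simp: repelling_cycle_def)
  obtain a where a: "\<And>i. i \<le> n \<Longrightarrow> a i \<in> A" "\<And>i. i \<le> n \<Longrightarrow> x i \<in> cball (a i) (r (a i))"
    "\<And>i. i < n \<Longrightarrow> 2 * (lip p q (norm (a i) + 3 * r (a i)) * r (a i)) \<le> r (a (Suc i))"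
    using labels_exist[of n x] E x(1) by blast
  have "a n = a 0" using label_unique[OF a(1)[of n] a(1)[of 0] a(2)[of n]] a(2)[of 0] x(2) by simp
  moreover have "norm (x i - a i) \<le> 3 * r (a i)" if "i < n" for i
    using a(2)[of i] rpos[OF a(1)[of i]] that by (simp add: dist_norm norm_minus_commute)
  ultimately have "norm l < 1" using a(1,3) by (intro multiplier_small[OF cyc l(1,2), of a]) auto
  then show False using l(3) by simp
qed

text \<open>Two visits of the orbit near \<open>\<zeta>\<close> to the same disc give an almost
  closed orbit segment, along which the correspondence contracts. The closing lemma gives a cycle
  near \<open>\<zeta>\<close>, and it is attracting by \<open>multiplier_small\<close>.\<close>

lemma orbit_limit_in_E_attracting:
  assumes x: "forward_orbit f x" "\<And>i. x i \<in> E" and s: "strict_mono s" "(x \<circ> s) \<longlonglongrightarrow> \<zeta>"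
  shows "\<zeta> \<in> dual_julia_set p q c"
proof -
  have x': "x (Suc i) \<in> f (x i)" for i using x(1) by (simp add: forward_orbit_def)
  have "\<exists>y n. attracting_cycle p q c n y \<and> dist (y 0) \<zeta> < \<epsilon>" if \<epsilon>: "\<epsilon> > 0" for \<epsilon>
  proof -
    have "\<forall>i. \<exists>a. a \<in> A \<and> x i \<in> cball a (r a)" using x(2) unfolding E_def by blast
    then obtain a where a: "\<And>i. a i \<in> A" "\<And>i. x i \<in> cball (a i) (r (a i))" by metis
    have chain: "2 * (lip p q (norm (a i) + 3 * r (a i)) * r (a i)) \<le> r (a (Suc i))" for i
    proof -
      obtain b where b: "\<And>j. j \<le> Suc i \<Longrightarrow> b j \<in> A \<and> x j \<in> cball (b j) (r (b j))"
        "2 * (lip p q (norm (b i) + 3 * r (b i)) * r (b i)) \<le> r (b (Suc i))"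
        using labels_exist[of "Suc i" x] x(2) x' by blast
      have "b j = a j" if "j \<le> Suc i" for j using label_unique[of "b j" "a j" "x j"] b(1)[OF that] a by simp
      then have "b i = a i" "b (Suc i) = a (Suc i)" by simp_all
      then show ?thesis using b(2) by simp
    qed
    have "A \<noteq> {}" using a(1) by blast
    define \<eta> where "\<eta> = min (\<epsilon> / 4) (Min (r ` A) / 4)"
    have "Min (r ` A) > 0" using \<open>A \<noteq> {}\<close> finA rpos by simp
    then have \<eta>: "\<eta> > 0" "\<eta> \<le> \<epsilon> / 4" using \<epsilon> by (auto simp: \<eta>_def)
    have \<eta>r: "\<eta> \<le> r b / 4" if "b \<in> A" for b
    proof -
      have "Min (r ` A) \<le> r b" using finA that by simp
      then show ?thesis by (simp add: \<eta>_def)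
    qed
    have "\<forall>\<^sub>F j in sequentially. dist ((x \<circ> s) j) \<zeta> < \<eta> / 2" by (rule tendstoD[OF s(2)]) (use \<eta>(1) in simp)
    then obtain J where J: "\<And>j. j \<ge> J \<Longrightarrow> dist (x (s j)) \<zeta> < \<eta> / 2" by (auto simp: eventually_sequentially)
    have inf: "infinite {J..}" by (rule infinite_Ici)
    have fin: "finite ((\<lambda>j. a (s j)) ` {J..})" using a(1) by (intro finite_subset[OF _ finA]) auto
    obtain j0 where j0: "infinite {j \<in> {J..}. a (s j) = a (s j0)}"
      using pigeonhole_infinite[OF inf fin] by blast
    have unb: "\<exists>k>m. k \<in> {j \<in> {J..}. a (s j) = a (s j0)}" for m
      using iffD1[OF infinite_nat_iff_unbounded j0] by blast
    obtain j where j: "j \<ge> J" "a (s j) = a (s j0)" using unb[of 0] by auto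
    obtain k where k: "k > j" "a (s k) = a (s j0)" using unb[of j] by auto
    define n where "n = s k - s j"
    have sjk: "s j < s k" using s(1) k(1) by (simp add: strict_monoD)
    then have n: "n \<ge> 1" "s j + n = s k" by (auto simp: n_def)
    define X b where "X = (\<lambda>i. x (s j + i))" and "b = (\<lambda>i. a (s j + i))"
    have bn: "b n = b 0" using n(2) j(2) k(2) by (simp add: b_def)
    have bA: "b i \<in> A" and rb: "r (b i) > 0" for i using a(1) rpos by (auto simp: b_def)
    have bch: "2 * (lip p q (norm (b i) + 3 * r (b i)) * r (b i)) \<le> r (b (Suc i))" for i
      using chain[of "s j + i"] by (simp add: b_def)
    have Xb: "norm (X i - b i) \<le> r (b i)" for i
      using a(2)[of "s j + i"] by (simp add: X_def b_def dist_norm norm_minus_commute)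
    define e where "e = (\<lambda>i. (1 / 2) ^ i * (r (b i) / r (b 0)))"
    have epos: "0 \<le> e i" for i using rb by (simp add: e_def less_imp_le)
    have e\<eta>: "2 * \<eta> * e i \<le> r (b i)" for i
    proof -
      have "2 * \<eta> * e i \<le> r (b 0) * e i"
        using \<eta>r[OF bA[of 0]] rb[of 0] epos by (intro mult_right_mono) auto
      also have "\<dots> = (1 / 2) ^ i * r (b i)" using rb[of 0] by (simp add: e_def)
      also have "\<dots> \<le> 1 * r (b i)" using rb[of i] by (intro mult_right_mono power_le_one) auto
      finally show ?thesis by simp
    qed
    have "\<exists>y. forward_orbit f y \<and> (\<forall>i. y (i + n) = y i) \<and> (\<forall>i\<le>n. norm (y i - X i) \<le> 2 * \<eta> * e i)"
    proof (rule closing_lemma)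
      show "v \<in> f u" if "U \<longlonglongrightarrow> u" "V \<longlonglongrightarrow> v" "\<And>m. V m \<in> f (U m)" for U V u v
        using corr_limit that by blast
      show "n \<ge> 1" using n by simp
      show "forward_orbit f X" using x' by (simp add: X_def forward_orbit_def)
      show "e 0 = 1" "e n \<le> 1 / 2"
        using rb[of 0] bn power_decreasing[OF n(1), of "1 / 2 :: real"] by (auto simp: e_def)
      show "0 \<le> e i" for i by (rule epos)
      show "norm (X n - X 0) \<le> \<eta>"
        using J[of j] J[of k] j(1) k(1) n(2) dist_triangle2[of "x (s k)" "x (s j)" \<zeta>]
        by (simp add: X_def dist_norm)
      fix y v assume y: "forward_orbit f y" and cl: "\<And>i. i \<le> n \<Longrightarrow> norm (y i - X i) \<le> 2 * \<eta> * e i"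
        and v: "norm (v - y 0) \<le> \<eta>"
      have yb: "norm (y i - b i) \<le> 2 * r (b i)" if "i \<le> n" for i
        using norm_triangle_ineq[of "y i - X i" "X i - b i"] cl[OF that] e\<eta>[of i] Xb[of i] by simp
      have "norm (v - y 0) \<le> 1 * r (b 0)" using v \<eta>r[OF bA[of 0]] rb[of 0] by simp
      then show "\<exists>y'. forward_orbit f y' \<and> y' 0 = v \<and> (\<forall>i\<le>n. norm (y' i - y i) \<le> e i * norm (v - y 0))"
        unfolding e_def using y yb bA bch
        by (intro forward_shadowing[where s = 1 and t = 2]) (auto simp: forward_orbit_def)
    qed
    then obtain y where y: "forward_orbit f y" "\<And>i. y (i + n) = y i" "\<And>i. i \<le> n \<Longrightarrow> norm (y i - X i) \<le> 2 * \<eta> * e i"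
      by blast
    have cyc: "is_cycle p q c n y" using y n by (simp add: is_cycle_def)
    have yb: "norm (y i - b i) \<le> 3 * r (b i)" if "i \<le> n" for i
      using norm_triangle_ineq[of "y i - X i" "X i - b i"] y(3)[OF that] e\<eta>[of i] Xb[of i] rb[of i] by simp
    have "attracting_cycle p q c n y"
    proof (cases "0 \<in> range y")
      case False
      obtain l where l: "is_multiplier p q c n y l" using is_multiplier_iff[OF q1 p1 cyc False] by blast
      have "norm l < 1" by (rule multiplier_small[OF cyc False l, of b]) (use bA bch bn yb in auto)
      then show ?thesis using cyc False l by (auto simp: attracting_cycle_def)
    qed (use cyc in \<open>auto simp: attracting_cycle_def\<close>)
    moreover have "dist (y 0) \<zeta> < \<epsilon>"
    proof -
      have "dist (y 0) (x (s j)) \<le> 2 * \<eta>" using y(3)[of 0] rb[of 0] by (simp add: e_def X_def dist_norm)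
      then show ?thesis using J[OF j(1)] \<eta> \<epsilon> dist_triangle[of "y 0" \<zeta> "x (s j)"] by linarith
    qed
    ultimately show ?thesis by blast
  qed
  then show ?thesis unfolding dual_julia_set_def closure_approachable
    by (metis (mono_tags, lifting) UnionI mem_Collect_eq rangeI)
qed

definition "critical_orbit = (\<Union>n\<in>{0<..}. image_iter f n 0)"

lemma critical_orbit_forward: "y \<in> critical_orbit \<Longrightarrow> w \<in> f y \<Longrightarrow> w \<in> critical_orbit"
proof -
  assume "y \<in> critical_orbit" "w \<in> f y"
  then obtain n where "n > 0" "y \<in> image_iter f n 0" by (auto simp: critical_orbit_def)
  then have "w \<in> image_iter f (Suc n) 0" using \<open>w \<in> f y\<close> by (auto simp: image_iter_def)
  then show "w \<in> critical_orbit" unfolding critical_orbit_def by blast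
qed

text \<open>For the orbit of \<open>0\<close> itself this is clear; it passes to the closure
  because the correspondence is Lipschitz.\<close>

lemma postcritical_set_forward:
  assumes "y \<in> postcritical_set p q c" "w \<in> f y" shows "w \<in> postcritical_set p q c"
proof -
  have "\<exists>w'\<in>critical_orbit. dist w' w < \<epsilon>" if "\<epsilon> > 0" for \<epsilon>
  proof -
    define L where "L = lip p q (norm y + 1)"
    have L: "L \<ge> 0" by (simp add: L_def lip_nonneg)
    define \<eta> where "\<eta> = min 1 (\<epsilon> / (L + 1))"
    have "\<eta> > 0" using that L by (simp add: \<eta>_def)
    then obtain y' where y': "y' \<in> critical_orbit" "dist y' y < \<eta>"
      using assms(1) unfolding postcritical_set_def critical_orbit_def[symmetric] closure_approachable by blast
    have "norm y' \<le> norm y + 1"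
      using y'(2) norm_triangle_sub[of y' y] by (simp add: \<eta>_def dist_norm)
    then obtain w' where w': "w' \<in> f y'" "norm (w' - w) \<le> L * norm (y' - y)"
      using corr_lipschitz[OF q1 pq _ _ assms(2), of "norm y + 1" y'] by (auto simp: L_def)
    have "L * norm (y' - y) \<le> L * \<eta>" using y'(2) L by (intro mult_left_mono) (auto simp: dist_norm)
    also have "\<dots> \<le> L * (\<epsilon> / (L + 1))" using L by (intro mult_left_mono) (auto simp: \<eta>_def)
    also have "\<dots> < \<epsilon>" using that L by (simp add: field_simps)
    finally have "dist w' w < \<epsilon>" using w'(2) by (simp add: dist_norm)
    then show ?thesis using critical_orbit_forward[OF y'(1) w'(1)] by blast
  qed
  then show ?thesis unfolding postcritical_set_def critical_orbit_def[symmetric] closure_approachable by blast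
qed

text \<open>Start \<open>n\<close> steps back at a point of the orbit of \<open>0\<close> in the
  same disc as \<open>y n\<close>. Following the given orbit forward to \<open>y 0\<close>
  contracts the distance by \<open>(1/2) ^ n\<close>.\<close>

lemma backward_orbit_in_E_postcritical:
  assumes y: "backward_orbit f y" "\<And>i. y i \<in> E"
  shows "y 0 \<in> postcritical_set p q c"
proof -
  obtain a0 where a0: "a0 \<in> A" "y 0 \<in> cball a0 (r a0)" using y(2)[of 0] unfolding E_def by blast
  have close: "\<exists>w\<in>critical_orbit. norm (w - y 0) \<le> (1 / 2) ^ n * (2 * r a0)" for n
  proof -
    define X where "X = (\<lambda>i. y (n - i))"
    have X: "X (Suc i) \<in> f (X i)" if "i < n" for i
      using y(1) that unfolding X_def backward_orbit_def by (metis Suc_diff_Suc)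
    have XE: "X i \<in> E" for i using y(2) by (simp add: X_def)
    obtain a where a: "\<And>i. i \<le> n \<Longrightarrow> a i \<in> A" "\<And>i. i \<le> n \<Longrightarrow> X i \<in> cball (a i) (r (a i))"
      "\<And>i. i < n \<Longrightarrow> 2 * (lip p q (norm (a i) + 3 * r (a i)) * r (a i)) \<le> r (a (Suc i))"
      using labels_exist[of n X] X XE by blast
    have Xa: "norm (X i - a i) \<le> 1 * r (a i)" if "i \<le> n" for i
      using a(2)[OF that] by (simp add: dist_norm norm_minus_commute)
    obtain v where v: "v \<in> critical_orbit" "norm (v - a 0) \<le> r (a 0)"
      using postcritical[OF a(1)[of 0]] unfolding critical_orbit_def by blast
    have "norm (v - X 0) \<le> 2 * r (a 0)"
      using v(2) Xa[of 0] norm_triangle_ineq4[of "v - a 0" "X 0 - a 0"] by simp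
    then obtain y' where y': "forward_orbit f y'" "y' 0 = v"
      "norm (y' n - X n) \<le> (1 / 2) ^ n * (r (a n) / r (a 0)) * norm (v - X 0)"
      using forward_shadowing[of n a X 1 v 2] a(1,3) X Xa by auto
    have "a n = a0" using label_unique[OF a(1) a0(1) a(2)] a0(2) by (simp add: X_def)
    have r0: "r (a 0) > 0" "r a0 > 0" using rpos a(1) a0(1) by auto
    have "(1 / 2) ^ n * (r (a n) / r (a 0)) * norm (v - X 0) \<le> (1 / 2) ^ n * (r (a n) / r (a 0)) * (2 * r (a 0))"
      using \<open>norm (v - X 0) \<le> 2 * r (a 0)\<close> r0 \<open>a n = a0\<close> by (intro mult_left_mono) auto
    also have "\<dots> = (1 / 2) ^ n * (2 * r a0)" using r0 \<open>a n = a0\<close> by simp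
    finally have "norm (y' n - y 0) \<le> (1 / 2) ^ n * (2 * r a0)" using y'(3) by (simp add: X_def)
    moreover have "y' i \<in> critical_orbit" for i
    proof (induction i)
      case (Suc i)
      then show ?case using y'(1) critical_orbit_forward by (auto simp: forward_orbit_def)
    qed (simp add: y'(2) v(1))
    ultimately show ?thesis by blast
  qed
  have "\<exists>w\<in>critical_orbit. dist w (y 0) < \<epsilon>" if "\<epsilon> > 0" for \<epsilon>
  proof -
    have "(\<lambda>n. (1 / 2 :: real) ^ n * (2 * r a0)) \<longlonglongrightarrow> 0 * (2 * r a0)"
      by (intro tendsto_mult tendsto_const LIMSEQ_realpow_zero) auto
    then have "\<forall>\<^sub>F n in sequentially. (1 / 2 :: real) ^ n * (2 * r a0) < \<epsilon>"
      using that by (intro order_tendstoD) auto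
    then obtain n where "(1 / 2 :: real) ^ n * (2 * r a0) < \<epsilon>" by (auto simp: eventually_sequentially)
    then show ?thesis using close[of n] by (auto simp: dist_norm intro: le_less_trans)
  qed
  then show ?thesis unfolding postcritical_set_def critical_orbit_def[symmetric] closure_approachable by blast
qed

section \<open>Julia set, hyperbolicity and backward orbits\<close>

text \<open>Every cycle lies in \<open>W\<close> or in \<open>E\<close>, and is repelling in the
  first case only.\<close>

theorem julia_set_eq: "julia_set p q c = repeller"
proof
  show "julia_set p q c \<subseteq> repeller"
    unfolding julia_set_def
  proof (rule closure_minimal[OF _ closed_repeller], safe)
    fix x n i assume x: "repelling_cycle p q c n x"
    then have "forward_orbit f x" by (simp add: repelling_cycle_def is_cycle_def)
    then show "x i \<in> repeller" using repelling_cycle_in_W[OF x] by (intro orbit_in_repeller) auto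
  qed
  show "repeller \<subseteq> julia_set p q c"
  proof
    fix \<zeta> assume \<zeta>: "\<zeta> \<in> repeller"
    have "\<exists>y\<in>\<Union>{range x |x n. repelling_cycle p q c n x}. dist y \<zeta> < \<epsilon>" if "\<epsilon> > 0" for \<epsilon>
    proof -
      obtain n x where x: "repelling_cycle p q c n x" "norm (x 0 - \<zeta>) < \<epsilon>"
        using repelling_cycle_near_repeller[OF \<zeta> \<open>\<epsilon> > 0\<close>] by blast
      then have "x 0 \<in> \<Union>{range x |x n. repelling_cycle p q c n x}" by blast
      then show ?thesis using x(2) by (auto simp: dist_norm)
    qed
    then show "\<zeta> \<in> julia_set p q c" unfolding julia_set_def closure_approachable by blast
  qed
qed

lemma dual_julia_set_subset_E: "dual_julia_set p q c \<subseteq> E"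
  unfolding dual_julia_set_def
proof (rule closure_minimal[OF _ compact_imp_closed[OF compact_E]], safe)
  fix x n i assume "attracting_cycle p q c n x"
  from attracting_cycle_in_E[OF this] show "x i \<in> E" by blast
qed

lemma sphere_orbit_None:
  assumes "forward_orbit (sphere_corr p q c) x" "x 0 = None" shows "x i = None"
proof (induction i)
  case (Suc i)
  have "x (Suc i) \<in> sphere_corr p q c (x i)" using assms(1) by (simp add: forward_orbit_def)
  then show ?case using Suc by simp
qed (rule assms(2))

lemma sphere_orbit_Some:
  assumes "forward_orbit (sphere_corr p q c) x" "x 0 = Some z"
  shows "\<exists>y. forward_orbit f y \<and> y 0 = z \<and> (\<forall>i. x i = Some (y i))"
proof -
  have nn: "x i \<noteq> None" for i
  proof (induction i)
    case (Suc i)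
    then obtain u where "x i = Some u" by blast
    moreover have "x (Suc i) \<in> sphere_corr p q c (x i)" using assms(1) by (simp add: forward_orbit_def)
    ultimately show ?case by auto
  qed (simp add: assms(2))
  have "the (x (Suc i)) \<in> f (the (x i))" for i
  proof -
    obtain u where u: "x i = Some u" using nn[of i] by blast
    have "x (Suc i) \<in> sphere_corr p q c (x i)" using assms(1) by (simp add: forward_orbit_def)
    then show ?thesis using u by auto
  qed
  then have "forward_orbit f (\<lambda>i. the (x i))" by (simp add: forward_orbit_def)
  moreover have "the (x 0) = z" using assms(2) by simp
  moreover have "x i = Some (the (x i))" for i using nn[of i] by simp
  ultimately show ?thesis by blast
qed

lemma limitin_sphere_Some:
  "limitin riemann_sphere (\<lambda>n. Some (y n)) (Some \<zeta>) sequentially \<longleftrightarrow> y \<longlonglongrightarrow> \<zeta>"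
proof
  assume L: "limitin riemann_sphere (\<lambda>n. Some (y n)) (Some \<zeta>) sequentially"
  show "y \<longlonglongrightarrow> \<zeta>"
  proof (rule topological_tendstoI)
    fix S assume "open S" "\<zeta> \<in> S"
    then have "\<forall>\<^sub>F n in sequentially. Some (y n) \<in> Some ` S"
      using L unfolding limitin_def by (metis imageI openin_Alexandroff_compactification_image_Some open_openin)
    then show "\<forall>\<^sub>F n in sequentially. y n \<in> S" by eventually_elim auto
  qed
next
  assume "y \<longlonglongrightarrow> \<zeta>"
  then have "limitin euclidean y \<zeta> sequentially" by simp
  from continuous_map_limit[OF continuous_map_Some this]
  show "limitin riemann_sphere (\<lambda>n. Some (y n)) (Some \<zeta>) sequentially" by (simp add: comp_def)
qed

text \<open>A finite point outside the repeller has no orbit that stays in \<open>W\<close>: an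
  orbit with a finite limit point never escapes and is therefore caught by \<open>E\<close>.
  Conversely a point of the repeller has an orbit with a limit point in the repeller, away from
  \<open>E\<close>.\<close>

theorem hyperbolic: "hyperbolic p q c"
proof -
  have "z \<notin> Some ` repeller \<longleftrightarrow> omega_limit_set p q c z \<subseteq> Some ` dual_julia_set p q c \<union> {None}" for z
  proof (cases z)
    case None
    have "\<zeta> = None" if "\<zeta> \<in> omega_limit_set p q c z" for \<zeta>
    proof -
      from that obtain x s where x: "forward_orbit (sphere_corr p q c) x" "x 0 = None"
          "limitin riemann_sphere (x \<circ> s) \<zeta> sequentially"
        unfolding omega_limit_set_def None by blast
      have "x \<circ> s = (\<lambda>n. None)" using sphere_orbit_None[OF x(1,2)] by auto
      with x(3) have L: "limitin riemann_sphere (\<lambda>n::nat. None) \<zeta> sequentially" by simp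
      show "\<zeta> = None"
      proof (rule ccontr)
        assume "\<zeta> \<noteq> None"
        then have "\<zeta> \<in> Some ` UNIV" by (cases \<zeta>) auto
        moreover have "openin riemann_sphere (Some ` UNIV)" by simp
        ultimately have "\<forall>\<^sub>F n::nat in sequentially. None \<in> Some ` (UNIV :: complex set)"
          using L unfolding limitin_def by blast
        then show False by (auto simp: eventually_sequentially)
      qed
    qed
    then show ?thesis using None by auto
  next
    case (Some u)
    show ?thesis
    proof
      assume "z \<notin> Some ` repeller"
      then have uL: "u \<notin> repeller" using Some by auto
      show "omega_limit_set p q c z \<subseteq> Some ` dual_julia_set p q c \<union> {None}"
      proof
        fix \<zeta>' assume "\<zeta>' \<in> omega_limit_set p q c z"
        then obtain x s where x: "forward_orbit (sphere_corr p q c) x" "x 0 = Some u" "strict_mono s"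
            "limitin riemann_sphere (x \<circ> s) \<zeta>' sequentially"
          unfolding omega_limit_set_def Some by blast
        obtain y where y: "forward_orbit f y" "y 0 = u" "\<And>i. x i = Some (y i)"
          using sphere_orbit_Some[OF x(1,2)] by blast
        show "\<zeta>' \<in> Some ` dual_julia_set p q c \<union> {None}"
        proof (cases \<zeta>')
          case (Some \<zeta>)
          have "x \<circ> s = (\<lambda>n. Some ((y \<circ> s) n))" using y(3) by auto
          then have lim: "(y \<circ> s) \<longlonglongrightarrow> \<zeta>" using x(4) Some limitin_sphere_Some[of "y \<circ> s" \<zeta>] by simp
          have R: "norm (y i) < R" for i
            using norm_less_if_subsequence_converges[OF y(1) x(3) lim] .
          obtain M where M: "y M \<in> E"
          proof (rule ccontr)
            assume "\<not> thesis"
            then have "y i \<in> W" for i using that R[of i] by (auto simp: W_def)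
            then show False using uL y(1,2) unfolding repeller_def by blast
          qed
          have yE: "y (M + i) \<in> E" for i
            by (rule orbit_stays_in_E[of y M]) (use y(1) R M in \<open>simp_all add: forward_orbit_def less_imp_le\<close>)
          have "\<zeta> \<in> dual_julia_set p q c"
          proof (rule orbit_limit_in_E_attracting)
            show "forward_orbit f (\<lambda>i. y (M + i))" using y(1) by (simp add: forward_orbit_def)
            have ge: "M \<le> s (j + M)" for j using seq_suble[OF x(3), of "j + M"] by simp
            show "strict_mono (\<lambda>j. s (j + M) - M)"
            proof (rule strict_monoI)
              fix i j :: nat assume "i < j"
              then have "s (i + M) < s (j + M)" using x(3) by (simp add: strict_monoD)
              then show "s (i + M) - M < s (j + M) - M" using ge[of i] by simp
            qed
            have "(\<lambda>i. y (M + i)) \<circ> (\<lambda>j. s (j + M) - M) = (\<lambda>j. (y \<circ> s) (j + M))" using ge by auto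
            then show "((\<lambda>i. y (M + i)) \<circ> (\<lambda>j. s (j + M) - M)) \<longlonglongrightarrow> \<zeta>"
              using LIMSEQ_ignore_initial_segment[OF lim, of M] by simp
          qed (rule yE)
          then show ?thesis using Some by simp
        qed simp
      qed
    next
      assume om: "omega_limit_set p q c z \<subseteq> Some ` dual_julia_set p q c \<union> {None}"
      show "z \<notin> Some ` repeller"
      proof
        assume "z \<in> Some ` repeller"
        then have "u \<in> repeller" using Some by auto
        then obtain x where x: "forward_orbit f x" "x 0 = u" "\<And>i. x i \<in> W" by (auto simp: repeller_def)
        have "\<forall>i. x i \<in> repeller" using orbit_in_repeller[OF x(1,3)] by blast
        then obtain \<zeta> s where s: "\<zeta> \<in> repeller" "strict_mono s" "(x \<circ> s) \<longlonglongrightarrow> \<zeta>"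
          using compact_repeller unfolding compact_def by blast
        have "forward_orbit (sphere_corr p q c) (\<lambda>i. Some (x i))" using x(1) by (simp add: forward_orbit_def)
        moreover have "limitin riemann_sphere ((\<lambda>i. Some (x i)) \<circ> s) (Some \<zeta>) sequentially"
          using s(3) limitin_sphere_Some[of "x \<circ> s" \<zeta>] by (simp add: comp_def)
        ultimately have "Some \<zeta> \<in> omega_limit_set p q c z"
          unfolding omega_limit_set_def using s(2) x(2) Some by blast
        then have "\<zeta> \<in> dual_julia_set p q c" using om by auto
        then show False using dual_julia_set_subset_E repeller_disjoint_E s(1) by blast
      qed
    qed
  qed
  moreover have "topspace riemann_sphere = UNIV"
    by (auto simp: notin_range_Some)
  ultimately show ?thesis unfolding hyperbolic_def julia_set_eq by auto
qed

text \<open>Backward orbits come into the large disc since forward orbits escape from its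
  complement. They cannot stay in \<open>E\<close>, since they would start in the post-critical
  set.\<close>

lemma backward_orbit_enters_W:
  assumes y: "backward_orbit f y" "y 0 \<notin> postcritical_set p q c"
  shows "\<exists>M. y M \<in> W"
proof -
  have y': "y i \<in> f (y (Suc i))" for i using y(1) by (simp add: backward_orbit_def)
  obtain m where m: "norm (y m) < R"
  proof (rule ccontr)
    assume "\<not> thesis"
    then have ge: "norm (y i) \<ge> R" for i using that by (cases "norm (y i) < R") auto
    have "norm (y 0) \<ge> 2 ^ i * norm (y i)" for i
    proof (induction i)
      case (Suc i)
      have "2 ^ i * norm (y i) \<ge> 2 ^ i * (2 * norm (y (Suc i)))"
        using escape[OF ge y'] by (intro mult_left_mono) auto
      moreover have "2 ^ Suc i * norm (y (Suc i)) = 2 ^ i * (2 * norm (y (Suc i)))" by simp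
      ultimately show ?case using Suc by linarith
    qed simp
    then have "norm (y 0) \<ge> 2 ^ i * R" for i
      using ge by (meson mult_left_mono order_trans zero_le_numeral zero_le_power)
    moreover obtain N where "norm (y 0) / R < 2 ^ N" using real_arch_pow[of 2 "norm (y 0) / R"] by auto
    then have "norm (y 0) < 2 ^ N * R" using Rpos by (simp add: field_simps)
    ultimately show False using not_less by blast
  qed
  have R: "norm (y (m + i)) < R" for i
  proof (induction i)
    case (Suc i)
    show ?case
    proof (rule ccontr)
      assume "\<not> norm (y (m + Suc i)) < R"
      then have "norm (y (m + i)) \<ge> 2 * norm (y (m + Suc i))" "norm (y (m + Suc i)) \<ge> R"
        using escape[OF _ y'[of "m + i"]] by auto
      then show False using Suc Rpos by linarith
    qed
  qed (simp add: m)
  show ?thesis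
  proof (rule ccontr)
    assume "\<nexists>M. y M \<in> W"
    then have yE: "y (m + i) \<in> E" for i using R by (auto simp: W_def)
    have "y (m + 0) \<in> postcritical_set p q c"
      by (rule backward_orbit_in_E_postcritical[of "\<lambda>i. y (m + i)"]) (use y' yE in \<open>simp_all add: backward_orbit_def\<close>)
    moreover have "y k \<in> postcritical_set p q c \<Longrightarrow> y 0 \<in> postcritical_set p q c" for k
      by (induction k) (use postcritical_set_forward y' in blast)+
    ultimately show False using y(2) by auto
  qed
qed

text \<open>A single backward orbit has to approach \<open>\<zeta>\<close> infinitely often. It is
  put together from pieces, each ending closer to \<open>\<zeta>\<close> than the one before; this
  is possible because after each piece the orbit is still in \<open>W\<close>.\<close>

theorem alpha_limit_set_eq:
  assumes z: "z \<notin> postcritical_set p q c"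
  shows "alpha_limit_set p q c z = repeller"
proof
  show "alpha_limit_set p q c z \<subseteq> repeller"
    unfolding alpha_limit_set_def using backward_orbit_enters_W backward_limit_in_repeller z by blast
  show "repeller \<subseteq> alpha_limit_set p q c z"
  proof
    fix \<zeta> assume \<zeta>: "\<zeta> \<in> repeller"
    \<comment> \<open>The state is a backward orbit and the time up to which it is final.\<close>
    define P where "P = (\<lambda>(j::nat) (S :: (nat \<Rightarrow> complex) \<times> nat). backward_orbit f (fst S) \<and> fst S 0 = z \<and>
      fst S (snd S) \<in> W \<and> (j > 0 \<longrightarrow> norm (fst S (snd S) - \<zeta>) < 1 / real j))"
    define T where "T = (\<lambda>(j::nat) (S :: (nat \<Rightarrow> complex) \<times> nat) (S' :: (nat \<Rightarrow> complex) \<times> nat).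
      snd S < snd S' \<and> (\<forall>i\<le>snd S. fst S' i = fst S i))"
    have "\<exists>S. \<forall>j. P j (S j) \<and> T j (S j) (S (Suc j))"
    proof (rule dependent_nat_choice)
      obtain y where y: "backward_orbit f y" "y 0 = z" using backward_orbit_exists by blast
      then obtain M where "y M \<in> W" using backward_orbit_enters_W z by blast
      then show "\<exists>S. P 0 S" using y by (intro exI[of _ "(y, M)"]) (simp add: P_def)
      fix S j assume S: "P j S"
      obtain t n where t: "backward_orbit f t" "t 0 = fst S (snd S)" "n \<ge> 1" "norm (t n - \<zeta>) < 1 / real (Suc j)"
        using backward_orbit_approaches_repeller[of "fst S (snd S)" \<zeta> "1 / real (Suc j)" 1] S \<zeta> by (auto simp: P_def)
      obtain y where y: "backward_orbit f y" "\<And>i. i \<le> snd S \<Longrightarrow> y i = fst S i" "\<And>i. y (snd S + i) = t i"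
        using splice_backward[of "snd S" "fst S" t] S t(1,2) by (auto simp: P_def backward_orbit_def)
      have "y (snd S) \<in> W" using S y(2) by (simp add: P_def)
      then have "y (snd S + n) \<in> W" using backward_orbit_stays_in_W[OF y(1)] by simp
      then have "P (Suc j) (y, snd S + n) \<and> T j S (y, snd S + n)"
        using S y t(3,4) by (simp add: P_def T_def)
      then show "\<exists>S'. P (Suc j) S' \<and> T j S S'" by blast
    qed
    then obtain S where S: "\<And>j. P j (S j)" "\<And>j. T j (S j) (S (Suc j))" by blast
    define m where "m = (\<lambda>j. snd (S j))"
    have mono: "strict_mono m" using S(2) by (simp add: strict_mono_Suc_iff m_def T_def)
    have agree: "fst (S j) i = fst (S k) i" if "k \<le> j" "i \<le> m k" for i j k
      using that(1)
    proof (induction j rule: dec_induct)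
      case (step j)
      have "i \<le> m j" using that(2) strict_mono_leD[OF mono step.hyps(1)] by simp
      then show ?case using S(2)[of j] step.IH by (simp add: T_def m_def)
    qed simp
    \<comment> \<open>The diagonal orbit: the orbit of stage \<open>i\<close> is final at least up
      to time \<open>i\<close>.\<close>
    define y where "y = (\<lambda>i. fst (S i) i)"
    have le: "i \<le> m i" for i using seq_suble[OF mono] .
    have "y i \<in> f (y (Suc i))" for i
    proof -
      have "y i = fst (S (Suc i)) i" using agree[of i "Suc i" i] le[of i] by (simp add: y_def)
      then show ?thesis using S(1)[of "Suc i"] by (simp add: y_def P_def backward_orbit_def)
    qed
    then have "backward_orbit f y" by (simp add: backward_orbit_def)
    moreover have "y 0 = z" using S(1)[of 0] by (simp add: y_def P_def)
    moreover have "(y \<circ> m) \<longlonglongrightarrow> \<zeta>"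
    proof (rule LIM_zero_cancel, rule tendsto_norm_zero_cancel,
        rule tendsto_sandwich[OF _ _ tendsto_const lim_1_over_n])
      show "\<forall>\<^sub>F j in sequentially. norm ((y \<circ> m) j - \<zeta>) \<le> 1 / real j"
      proof (rule eventually_mono[OF eventually_gt_at_top[of 0]])
        fix j :: nat assume "j > 0"
        have "(y \<circ> m) j = fst (S j) (m j)" using agree[OF le[of j] order_refl] by (simp add: y_def)
        then show "norm ((y \<circ> m) j - \<zeta>) \<le> 1 / real j" using S(1)[of j] \<open>j > 0\<close> by (simp add: P_def m_def)
      qed
    qed auto
    ultimately show "\<zeta> \<in> alpha_limit_set p q c z"
      unfolding alpha_limit_set_def using mono by blast
  qed
qed

end

section \<open>Existence of traps\<close>

lemma finite_positive_bound:
  fixes h :: "'a \<Rightarrow> real"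
  assumes "finite S" "\<And>x. x \<in> S \<Longrightarrow> h x > 0"
  shows "\<exists>g>0. \<forall>x\<in>S. g \<le> h x"
proof -
  have "\<forall>x\<in>S. Min (insert 1 (h ` S)) \<le> h x" using assms(1) by simp
  moreover have "Min (insert 1 (h ` S)) > 0" using assms by simp
  ultimately show ?thesis by blast
qed

lemma finite_descendants:
  assumes "wf r" "\<And>a. finite {b. (b, a) \<in> r}"
  shows "finite {b. (b, a) \<in> r\<^sup>*}"
  using assms(1)
proof (induction a rule: wf_induct_rule)
  case (less a)
  have "{b. (b, a) \<in> r\<^sup>*} \<subseteq> insert a (\<Union>e\<in>{e. (e, a) \<in> r}. {b. (b, e) \<in> r\<^sup>*})"
    by (auto elim: rtranclE)
  moreover have "finite (insert a (\<Union>e\<in>{e. (e, a) \<in> r}. {b. (b, e) \<in> r\<^sup>*}))"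
    using assms(2) less by auto
  ultimately show ?case by (rule finite_subset)
qed

text \<open>In an acyclic graph the number of ancestors is a level function: it grows along every
  edge.\<close>

lemma ancestor_count_less:
  assumes "wf r" "finite {e. (b, e) \<in> r\<^sup>+}" "(b, a) \<in> r"
  shows "card {e. (a, e) \<in> r\<^sup>+} < card {e. (b, e) \<in> r\<^sup>+}"
proof (rule psubset_card_mono[OF assms(2)])
  have "(a, a) \<notin> r\<^sup>+" using wf_acyclic[OF assms(1)] by (simp add: acyclic_def)
  moreover have "(b, a) \<in> r\<^sup>+" using assms(3) by blast
  moreover have "{e. (a, e) \<in> r\<^sup>+} \<subseteq> {e. (b, e) \<in> r\<^sup>+}"
    using assms(3) by (auto intro: trancl_into_trancl2)
  ultimately show "{e. (a, e) \<in> r\<^sup>+} \<subset> {e. (b, e) \<in> r\<^sup>+}" by blast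
qed

text \<open>The post-critical orbit inside the disc of radius \<open>R\<close>. Stopping at
  \<open>0\<close> loses no points, because the only value at \<open>0\<close> is the starting
  point \<open>c\<close>, and it removes the cycles through \<open>0\<close> from the graph of the
  orbit.\<close>

inductive_set reach :: "nat \<Rightarrow> nat \<Rightarrow> complex \<Rightarrow> real \<Rightarrow> complex set" for p q c R where
  base: "c \<in> reach p q c R"
| step: "a \<in> reach p q c R \<Longrightarrow> a \<noteq> 0 \<Longrightarrow> b \<in> corr p q c a \<Longrightarrow> norm b \<le> R \<Longrightarrow> b \<in> reach p q c R"

definition critical_orbits_return :: "nat \<Rightarrow> nat \<Rightarrow> complex \<Rightarrow> bool" where
  "critical_orbits_return p q c \<longleftrightarrow>
    (\<forall>x. forward_orbit (corr p q c) x \<longrightarrow> x 0 = 0 \<longrightarrow> bounded (range x) \<longrightarrow> (\<exists>i\<ge>1. x i = 0))"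

lemma reach_norm: "norm c \<le> R \<Longrightarrow> a \<in> reach p q c R \<Longrightarrow> norm a \<le> R"
  by (erule reach.cases) auto

lemma forward_orbit_prepend:
  assumes "forward_orbit F x" "x 0 \<in> F a" shows "forward_orbit F (case_nat a x)"
  using assms by (auto simp: forward_orbit_def split: nat.split)

lemma reach_orbit_from_critical_value:
  assumes "a \<in> reach p q c R" "norm c \<le> R"
    and "forward_orbit (corr p q c) x" "x 0 = a" "\<And>i. x i \<noteq> 0" "\<And>i. norm (x i) \<le> R"
  shows "\<exists>y. forward_orbit (corr p q c) y \<and> y 0 = c \<and> (\<forall>i. y i \<noteq> 0 \<and> norm (y i) \<le> R)"
  using assms(1,3-)
proof (induction arbitrary: x rule: reach.induct)
  case base
  then show ?case by blast
next
  case (step a b)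
  show ?case
  proof (rule step.IH)
    show "forward_orbit (corr p q c) (case_nat a x)"
      using step.prems step.hyps by (intro forward_orbit_prepend) auto
    show "case_nat a x 0 = a" by simp
    show "case_nat a x i \<noteq> 0" for i using step.prems step.hyps by (cases i) auto
    show "norm (case_nat a x i) \<le> R" for i
      using step.prems reach_norm[OF assms(2) step.hyps(1)] by (cases i) auto
  qed
qed

text \<open>An infinite path in the graph that avoids \<open>0\<close> would prolong to a bounded
  orbit of \<open>0\<close> that never returns. So the graph is well-founded, and as it is
  finitely branching it is finite.\<close>

lemma reach_structure:
  assumes q1: "q \<ge> 1" and pq: "p > q" and cr: "critical_orbits_return p q c" and cR: "norm c \<le> R"
  shows "finite (reach p q c R)"
    and "\<exists>d :: complex \<Rightarrow> nat. \<forall>a\<in>reach p q c R. a \<noteq> 0 \<longrightarrow> (\<forall>b\<in>corr p q c a. norm b \<le> R \<longrightarrow> d a < d b)"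
proof -
  define A where "A = reach p q c R"
  define E where "E = {(b, a). a \<in> A \<and> a \<noteq> 0 \<and> b \<in> corr p q c a \<and> norm b \<le> R}"
  have wf: "wf E"
  proof (rule ccontr)
    assume "\<not> wf E"
    then obtain g where g: "\<And>i. (g (Suc i), g i) \<in> E" unfolding wf_iff_no_infinite_down_chain by blast
    have A: "g i \<in> A" "g i \<noteq> 0" "g (Suc i) \<in> corr p q c (g i)" for i using g[of i] by (auto simp: E_def)
    have "forward_orbit (corr p q c) g" using A(3) by (simp add: forward_orbit_def)
    then obtain y where y: "forward_orbit (corr p q c) y" "y 0 = c" "\<And>i. y i \<noteq> 0 \<and> norm (y i) \<le> R"
      using reach_orbit_from_critical_value[of "g 0" p q c R g] A reach_norm[OF cR] cR
      unfolding A_def by blast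
    have "forward_orbit (corr p q c) (case_nat 0 y)"
      using y q1 pq by (intro forward_orbit_prepend) (auto simp: corr_zero)
    moreover have "bounded (range (case_nat 0 y))"
    proof (rule boundedI)
      fix v assume "v \<in> range (case_nat 0 y)"
      then obtain i where "v = case_nat 0 y i" by blast
      then show "norm v \<le> max 0 R" using y(3) by (cases i) (auto simp: le_max_iff_disj)
    qed
    ultimately obtain i where "i \<ge> 1" "case_nat 0 y i = 0"
      using cr unfolding critical_orbits_return_def by (metis nat.case(1))
    then show False using y(3) by (cases i) auto
  qed
  have fin: "finite {b. (b, a) \<in> E}" for a
    by (rule finite_subset[OF _ finite_corr[OF q1, of p c a]]) (auto simp: E_def)
  have "(a, c) \<in> E\<^sup>*" if "a \<in> A" for a
    using that unfolding A_def
  proof (induction rule: reach.induct)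
    case (step a b)
    then have "(b, a) \<in> E" by (simp add: E_def A_def)
    then show ?case using step.IH by (rule converse_rtrancl_into_rtrancl)
  qed simp
  then have "A \<subseteq> {b. (b, c) \<in> E\<^sup>*}" by blast
  then have finA: "finite A" using finite_descendants[OF wf fin] by (rule finite_subset)
  then show "finite (reach p q c R)" by (simp add: A_def)
  have "E \<subseteq> A \<times> A" unfolding E_def A_def using reach.step by blast
  then have "E\<^sup>+ \<subseteq> A \<times> A" by (rule trancl_subset_Sigma)
  then have fin': "finite {e. (b, e) \<in> E\<^sup>+}" for b
    by (intro finite_subset[OF _ finA]) blast
  have "card {e. (a, e) \<in> E\<^sup>+} < card {e. (b, e) \<in> E\<^sup>+}"
    if "a \<in> A" "a \<noteq> 0" "b \<in> corr p q c a" "norm b \<le> R" for a b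
    using that by (intro ancestor_count_less wf fin') (simp add: E_def)
  then show "\<exists>d :: complex \<Rightarrow> nat. \<forall>a\<in>reach p q c R. a \<noteq> 0 \<longrightarrow> (\<forall>b\<in>corr p q c a. norm b \<le> R \<longrightarrow> d a < d b)"
    unfolding A_def by (intro exI[of _ "\<lambda>a. card {e. (a, e) \<in> E\<^sup>+}"]) blast
qed

text \<open>Away from \<open>0\<close> the radii grow geometrically with the level
  \<open>d\<close>, by a factor \<open>M\<close> that beats the Lipschitz constant. The edges into
  \<open>0\<close> close up the cycles of the graph: they require the radius \<open>\<rho>\<close>
  at \<open>0\<close> to be at least \<open>M ^ Suc N\<close> times the basic radius
  \<open>\<epsilon>\<close>. But leaving \<open>0\<close> needs only a radius
  \<open>\<epsilon>\<close> of order \<open>\<rho>\<close> to the power \<open>p/q\<close>, so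
  that both requirements are met for small \<open>\<rho>\<close>.\<close>

lemma radii_exist:
  assumes q1: "q \<ge> 1" and pq: "p > q" and finA: "finite A" and s: "s > 0"
    and d: "\<And>a b. a \<in> A \<Longrightarrow> a \<noteq> 0 \<Longrightarrow> b \<in> A \<Longrightarrow> b \<in> corr p q c a \<Longrightarrow> (d a :: nat) < d b"
  shows "\<exists>r. (\<forall>a\<in>A. 0 < r a \<and> r a < s) \<and>
    (\<forall>a\<in>A. \<forall>b\<in>A. b \<in> corr p q c a \<longrightarrow> 4 * (lip p q (norm a + 3 * r a) * r a) \<le> r b)"
proof -
  define k where "k = real p / real q"
  have k: "k > 1" using q1 pq by (simp add: k_def)
  obtain B where B: "\<And>a. a \<in> A \<Longrightarrow> norm a \<le> B"
    using finite_imp_bounded[OF finA] unfolding bounded_iff by blast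
  define M where "M = 4 * max 1 (lip p q (B + 3))"
  have M: "M \<ge> 1" "M > 0" by (auto simp: M_def)
  define N where "N = (\<Sum>a\<in>A. d a)"
  have N: "d a \<le> N" if "a \<in> A" for a
    unfolding N_def using finA that by (intro member_le_sum) auto
  define K where "K = 4 * lip p q 3"
  have K: "K > 0" using q1 pq by (simp add: K_def lip_def)
  define \<rho> where "\<rho> = min (min (s / 2) 1) ((1 / (K * M ^ Suc N)) powr (1 / (k - 1)))"
  have KM: "K * M ^ Suc N > 0" using K M by simp
  have \<rho>: "0 < \<rho>" "\<rho> < s" "\<rho> \<le> 1" using s KM by (auto simp: \<rho>_def)
  have "\<rho> powr (k - 1) \<le> ((1 / (K * M ^ Suc N)) powr (1 / (k - 1))) powr (k - 1)"
    using \<rho> k by (intro powr_mono2) (auto simp: \<rho>_def)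
  also have "\<dots> = 1 / (K * M ^ Suc N)" using k KM by (simp add: powr_powr)
  finally have \<rho>k: "K * M ^ Suc N * \<rho> powr (k - 1) \<le> 1" using KM by (simp add: field_simps)
  define \<epsilon> where "\<epsilon> = K * \<rho> powr (k - 1) * \<rho>"
  have \<epsilon>: "\<epsilon> > 0" using K \<rho> by (simp add: \<epsilon>_def)
  have \<epsilon>\<rho>: "\<epsilon> * M ^ Suc N \<le> \<rho>"
  proof -
    have "\<epsilon> * M ^ Suc N = (K * M ^ Suc N * \<rho> powr (k - 1)) * \<rho>" by (simp add: \<epsilon>_def ac_simps)
    also have "\<dots> \<le> 1 * \<rho>" using \<rho>k \<rho> by (intro mult_right_mono) auto
    finally show ?thesis by simp
  qed
  define r where "r = (\<lambda>a. if a = 0 then \<rho> else \<epsilon> * M ^ d a)"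
  have \<epsilon>M: "\<epsilon> * M ^ m \<le> \<epsilon> * M ^ n" if "m \<le> n" for m n
    using M \<epsilon> that by (intro mult_left_mono power_increasing) auto
  have r\<rho>: "r a \<le> \<rho>" if "a \<in> A" for a
    using \<epsilon>M[of "d a" "Suc N"] N[OF that] \<epsilon>\<rho> by (simp add: r_def)
  have rpos: "0 < r a" for a using \<rho> \<epsilon> M by (simp add: r_def)
  have r\<epsilon>: "\<epsilon> \<le> r b" if "b \<in> A" for b
    using \<epsilon>M[of 0 "d b"] \<epsilon>M[of 0 "Suc N"] \<epsilon>\<rho> by (auto simp: r_def)
  have "4 * (lip p q (norm a + 3 * r a) * r a) \<le> r b"
    if a: "a \<in> A" and b: "b \<in> A" and ab: "b \<in> corr p q c a" for a b
  proof (cases "a = 0")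
    case True
    have "lip p q (3 * \<rho>) = lip p q 3 * \<rho> powr (k - 1)"
      using \<rho> by (simp add: lip_def powr_mult k_def)
    then have "4 * (lip p q (norm a + 3 * r a) * r a) = \<epsilon>"
      using True by (simp add: r_def \<epsilon>_def K_def)
    then show ?thesis using r\<epsilon>[OF b] by simp
  next
    case False
    have "norm a + 3 * r a \<le> B + 3" using B[OF a] r\<rho>[OF a] \<rho>(3) by simp
    then have "lip p q (norm a + 3 * r a) \<le> lip p q (B + 3)"
      using rpos[of a] by (intro lip_mono q1 pq) auto
    then have "4 * lip p q (norm a + 3 * r a) \<le> M" by (simp add: M_def)
    then have "4 * lip p q (norm a + 3 * r a) * r a \<le> M * r a"
      using rpos[of a] by (intro mult_right_mono) auto
    also have "M * r a = \<epsilon> * M ^ Suc (d a)" using False by (simp add: r_def)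
    also have "\<dots> \<le> r b"
    proof (cases "b = 0")
      case True
      then show ?thesis using \<epsilon>M[of "Suc (d a)" "Suc N"] N[OF a] \<epsilon>\<rho> by (simp add: r_def)
    next
      case b0: False
      then show ?thesis using \<epsilon>M[of "Suc (d a)" "d b"] d[OF a False b ab] by (simp add: r_def)
    qed
    finally show ?thesis by (simp add: mult.assoc)
  qed
  moreover have "0 < r a \<and> r a < s" if "a \<in> A" for a using rpos r\<rho>[OF that] \<rho>(2) by simp
  ultimately show ?thesis by blast
qed

lemma escape_radius:
  assumes q1: "q \<ge> 1" and pq: "p > q" and R: "R > 0" "3 \<le> R powr (real p / real q - 1)" and c: "norm c < R"
    and z: "R \<le> norm z" and w: "w \<in> corr p q c z"
  shows "2 * norm z \<le> norm w"
proof -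
  have "3 * norm z \<le> norm z powr (real p / real q - 1) * norm z"
    using R z q1 pq by (intro mult_right_mono order_trans[OF R(2)] powr_mono2) auto
  also have "\<dots> = norm z powr (real p / real q)" using R z by (simp add: powr_diff)
  also have "\<dots> = norm (w - c)" using corr_norm[OF q1 _ w] q1 pq by simp
  also have "\<dots> \<le> norm w + norm c" by (rule norm_triangle_ineq4)
  finally show ?thesis using c z by linarith
qed

text \<open>The discs are chosen for \<open>c0\<close>. Replacing \<open>c0\<close> by
  \<open>c\<close> translates all values by \<open>c - c0\<close>, and this is absorbed by the gap
  between the bound \<open>r b / 4\<close> for the image of a disc and the radius \<open>r
  b\<close> of the target disc.\<close>

lemma trap_exists_near:
  assumes q1: "q \<ge> 1" and pq: "p > q" and cr: "critical_orbits_return p q c0"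
  shows "\<exists>\<delta>>0. \<exists>R A r. \<forall>c\<in>ball c0 \<delta>. trap p q c R A r"
proof -
  have p1: "p \<ge> 1" using q1 pq by simp
  define k where "k = real p / real q"
  have k: "k > 1" using q1 pq by (simp add: k_def)
  define R0 where "R0 = max (norm c0 + 2) (3 powr (1 / (k - 1)))"
  have R0: "norm c0 + 2 \<le> R0" "3 powr (1 / (k - 1)) \<le> R0" by (auto simp: R0_def)
  have R0pos: "R0 \<ge> 2" using R0(1) norm_ge_zero[of c0] by linarith
  define A where "A = reach p q c0 R0"
  have c0R: "norm c0 \<le> R0" using R0(1) by simp
  have finA: "finite A" unfolding A_def by (rule reach_structure(1)[OF q1 pq cr c0R])
  obtain d :: "complex \<Rightarrow> nat" where d: "\<And>a b. a \<in> A \<Longrightarrow> a \<noteq> 0 \<Longrightarrow> b \<in> corr p q c0 a \<Longrightarrow> norm b \<le> R0 \<Longrightarrow> d a < d b"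
    using reach_structure(2)[OF q1 pq cr c0R] unfolding A_def by blast
  have AR: "norm a \<le> R0" if "a \<in> A" for a using reach_norm[OF c0R] that by (simp add: A_def)
  have c0A: "c0 \<in> A" by (simp add: A_def reach.base)
  have Astep: "b \<in> A" if "a \<in> A" "b \<in> corr p q c0 a" "norm b \<le> R0" for a b
    using that c0A reach.step[of a p q c0 R0 b] p1 q1 by (cases "a = 0") (auto simp: A_def corr_zero)
  define F where "F = (\<Union>a\<in>A. corr p q c0 a)"
  have "finite {b \<in> F. R0 < norm b}" using finA finite_corr[OF q1] by (simp add: F_def)
  \<comment> \<open>The gap between \<open>R0\<close> and the values that leave the disc is at
    least \<open>2 * g\<close>.\<close>
  then obtain g where g: "g > 0" "\<And>b. b \<in> F \<Longrightarrow> R0 < norm b \<Longrightarrow> g \<le> (norm b - R0) / 2"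
    using finite_positive_bound[of "{b \<in> F. R0 < norm b}" "\<lambda>b. (norm b - R0) / 2"] by auto
  have "finite {ab \<in> A \<times> A. fst ab \<noteq> snd ab}" using finA by simp
  then obtain sep where sep: "sep > 0" "\<And>a b. a \<in> A \<Longrightarrow> b \<in> A \<Longrightarrow> a \<noteq> b \<Longrightarrow> sep \<le> dist a b"
    using finite_positive_bound[of "{ab \<in> A \<times> A. fst ab \<noteq> snd ab}" "\<lambda>ab. dist (fst ab) (snd ab)"] by auto
  define L where "L = lip p q (R0 + 1)"
  have L: "L \<ge> 0" by (simp add: L_def lip_nonneg)
  \<comment> \<open>The bounds on the radii: \<open>1\<close> makes \<open>L\<close> a Lipschitz
    constant on the discs, \<open>g\<close> keeps the discs inside the disc of radius \<open>R0 +
    g\<close>, \<open>sep / 2\<close> makes them disjoint, and the last one keeps all values close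
    to a value outside \<open>A\<close> outside that disc as well.\<close>
  define s where "s = min (min 1 g) (min (sep / 2) (g / (2 * (L + 1))))"
  have s: "s > 0" using g sep L by (auto simp: s_def)
  have s: "s > 0" "s \<le> 1" "s \<le> g" "s \<le> sep / 2" "s \<le> g / (2 * (L + 1))"
    using s by (simp_all only: s_def min_le_iff_disj order_refl simp_thms)
  have Ls: "L * s \<le> g / 2"
  proof -
    have "L * s \<le> (L + 1) * (g / (2 * (L + 1)))" using s L by (intro mult_mono) auto
    also have "\<dots> = g / 2" using L by (simp add: field_simps)
    finally show ?thesis .
  qed
  obtain r where r: "\<And>a. a \<in> A \<Longrightarrow> 0 < r a" "\<And>a. a \<in> A \<Longrightarrow> r a < s"
    "\<And>a b. a \<in> A \<Longrightarrow> b \<in> A \<Longrightarrow> b \<in> corr p q c0 a \<Longrightarrow> 4 * (lip p q (norm a + 3 * r a) * r a) \<le> r b"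
    using radii_exist[OF q1 pq finA s(1), of c0 d] d AR by blast
  obtain m where m: "m > 0" "\<And>a. a \<in> A \<Longrightarrow> m \<le> r a"
    using finite_positive_bound[OF finA, of r] r(1) by blast
  define \<delta> where "\<delta> = min (m / 4) (min (g / 2) 1)"
  have \<delta>: "\<delta> > 0" "\<delta> \<le> m / 4" "\<delta> \<le> g / 2" "\<delta> \<le> 1" using m(1) g(1) by (auto simp: \<delta>_def)
  have \<delta>r: "\<delta> \<le> r a / 4" if "a \<in> A" for a using m(2)[OF that] \<delta>(2) by linarith
  \<comment> \<open>At most halfway between \<open>R0\<close> and the nearest value outside, so
    that no point of the orbit is close to the boundary circle.\<close>
  define R where "R = R0 + g"
  have lip3: "lip p q (norm a + r a) * r a \<le> lip p q (norm a + 3 * r a) * r a" if "a \<in> A" for a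
    using r(1)[OF that] by (intro mult_right_mono lip_mono q1 pq) auto
  have "trap p q c R A r" if c: "c \<in> ball c0 \<delta>" for c
  proof
    have cc: "norm (c - c0) < \<delta>" using c by (simp add: dist_norm norm_minus_commute)
    then have cR: "norm c < R"
      using norm_triangle_sub[of c c0] \<delta>(4) R0(1) g(1) by (simp add: R_def)
    show "q \<ge> 1" "q < p" by fact+
    show "R > 0" using R0pos g(1) by (simp add: R_def)
    show "2 * norm z \<le> norm w" if "R \<le> norm z" "w \<in> corr p q c z" for z w
    proof (rule escape_radius[OF q1 pq \<open>R > 0\<close> _ cR that])
      have "3 = (3 powr (1 / (k - 1))) powr (k - 1)" using k by (simp add: powr_powr)
      also have "\<dots> \<le> R powr (k - 1)" using R0(2) g(1) k by (intro powr_mono2) (auto simp: R_def)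
      finally show "3 \<le> R powr (real p / real q - 1)" by (simp add: k_def)
    qed
    show "finite A" by fact
    show "0 < r a" if "a \<in> A" for a using r(1) that .
    show "cball a (r a) \<subseteq> ball 0 R" if "a \<in> A" for a
    proof
      fix z assume "z \<in> cball a (r a)"
      then have "norm (z - a) \<le> r a" by (simp add: dist_norm norm_minus_commute)
      then show "z \<in> ball 0 R"
        using norm_triangle_sub[of z a] AR[OF that] r(2)[OF that] s(3) by (simp add: R_def)
    qed
    show "cball a (r a) \<inter> cball b (r b) = {}" if "a \<in> A" "b \<in> A" "a \<noteq> b" for a b
    proof -
      have "r a + r b < dist a b" using sep(2)[OF that] r(2)[OF that(1)] r(2)[OF that(2)] s(4) by linarith
      then have "False" if "dist a z \<le> r a" "dist b z \<le> r b" for z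
        using dist_triangle2[of a b z] that by (simp add: dist_commute)
      then show ?thesis by auto
    qed
    show "\<exists>b\<in>A. c \<in> ball b (r b)"
      using c0A cc \<delta>r[OF c0A] r(1)[OF c0A] by (intro bexI[of _ c0]) (auto simp: dist_norm norm_minus_commute)
    show "\<exists>b\<in>A. w \<in> ball b (r b) \<and> 2 * (lip p q (norm a + 3 * r a) * r a) \<le> r b"
      if a: "a \<in> A" and z: "z \<in> cball a (r a)" and w: "w \<in> corr p q c z" and wR: "norm w \<le> R" for a z w
    proof -
      define w0 where "w0 = w + (c0 - c)"
      have w0: "w0 \<in> corr p q c0 z" using w corr_shift[of w p q c z c0] by (simp add: w0_def)
      have za: "norm (a - z) \<le> r a" using z by (simp add: dist_norm)
      have "norm z \<le> norm a + r a" using za norm_triangle_sub[of z a] by (simp add: norm_minus_commute)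
      moreover have "norm a \<le> norm a + r a" using r(1)[OF a] by simp
      ultimately obtain b where b: "b \<in> corr p q c0 a" "norm (b - w0) \<le> lip p q (norm a + r a) * norm (a - z)"
        using corr_lipschitz[OF q1 pq _ _ w0] by blast
      have bw0: "norm (b - w0) \<le> lip p q (norm a + r a) * r a"
        using b(2) za by (meson lip_nonneg mult_left_mono order_trans)
      have "norm (c0 - c) < \<delta>" using cc by (simp add: norm_minus_commute)
      moreover have "norm (b - w) \<le> norm (b - w0) + norm (c0 - c)"
        using norm_triangle_ineq[of "b - w0" "c0 - c"] by (simp add: w0_def)
      ultimately have bw: "norm (b - w) < norm (b - w0) + \<delta>" by linarith
      have "norm b \<le> R0"
      proof (rule ccontr)
        assume "\<not> norm b \<le> R0"
        then have "R0 < norm b" by simp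
        moreover have "b \<in> F" unfolding F_def using a b(1) by blast
        ultimately have "g \<le> (norm b - R0) / 2" by (intro g(2))
        moreover have "lip p q (norm a + r a) * r a \<le> L * s"
          unfolding L_def using AR[OF a] r(1,2)[OF a] s(2)
          by (intro mult_mono lip_mono q1 pq) (auto simp: lip_nonneg)
        moreover have "norm b \<le> norm w + norm (b - w)" by (rule norm_triangle_sub)
        ultimately show False using bw bw0 Ls \<delta>(3) wR by (simp add: R_def)
      qed
      then have bA: "b \<in> A" using Astep a b(1) by blast
      have "4 * (lip p q (norm a + 3 * r a) * r a) \<le> r b" by (rule r(3)[OF a bA b(1)])
      moreover have "0 \<le> lip p q (norm a + 3 * r a) * r a" using r(1)[OF a] by (simp add: lip_nonneg)
      ultimately show ?thesis
        using bA bw bw0 lip3[OF a] \<delta>r[OF bA] r(1)[OF bA] by (intro bexI[of _ b]) (auto simp: dist_norm)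
    qed
    show "\<exists>y\<in>(\<Union>n\<in>{0<..}. image_iter (corr p q c) n 0). norm (y - a) \<le> r a" if "a \<in> A" for a
      using that unfolding A_def
    proof (induction rule: reach.induct)
      case base
      have "c \<in> image_iter (corr p q c) 1 0" using p1 q1 by (simp add: image_iter_def corr_zero)
      then show ?case using cc \<delta>r[OF c0A] r(1)[OF c0A]
        by (intro bexI[of _ c] UN_I[of 1]) auto
    next
      case (step a b)
      have aA: "a \<in> A" and bA: "b \<in> A" using step.hyps reach.step by (auto simp: A_def)
      obtain y n where y: "n > 0" "y \<in> image_iter (corr p q c) n 0" "norm (y - a) \<le> r a"
        using step.IH by auto
      have "norm y \<le> norm a + r a" using y(3) norm_triangle_sub[of y a] by simp
      moreover have "norm a \<le> norm a + r a" using r(1)[OF aA] by simp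
      ultimately obtain w0 where w0: "w0 \<in> corr p q c0 y" "norm (w0 - b) \<le> lip p q (norm a + r a) * norm (y - a)"
        using corr_lipschitz[OF q1 pq _ _ step.hyps(3)] by blast
      have "norm (w0 - b) \<le> lip p q (norm a + r a) * r a"
        using w0(2) y(3) by (meson lip_nonneg mult_left_mono order_trans)
      then have "norm (w0 - b) \<le> r b / 4" using lip3[OF aA] r(3)[OF aA bA step.hyps(3)] by linarith
      define w where "w = w0 + (c - c0)"
      have "w \<in> corr p q c y" using w0(1) corr_shift[of w0 p q c0 y c] by (simp add: w_def)
      then have "w \<in> image_iter (corr p q c) (Suc n) 0" using y(2) by (auto simp: image_iter_def)
      moreover have "norm (w - b) \<le> r b"
        using norm_triangle_ineq[of "w0 - b" "c - c0"] \<open>norm (w0 - b) \<le> r b / 4\<close> cc \<delta>r[OF bA] r(1)[OF bA]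
        by (simp add: w_def algebra_simps)
      ultimately show ?case by (intro bexI[of _ w] UN_I[of "Suc n"]) auto
    qed
  qed
  then show ?thesis using \<delta>(1) by blast
qed

text \<open>\<open>H\<close> is the interior of the set of all parameters with the required
  properties; the traps provide enough interior points.\<close>

theorem theorem1p5:
  fixes p q :: nat
  assumes "q \<ge> 1" and "p > q"
  shows "\<exists>H :: complex set. open H \<and>
           UNIV - mandelbrot_set p q \<subseteq> H \<and> {c. simple_centre p q c} \<subseteq> H \<and>
           (\<forall>c\<in>H. hyperbolic p q c) \<and>
           (\<forall>c\<in>H. \<forall>z. z \<notin> postcritical_set p q c \<longrightarrow>
                    alpha_limit_set p q c z = julia_set p q c)"
proof -
  define G where "G = {c. hyperbolic p q c \<and>
    (\<forall>z. z \<notin> postcritical_set p q c \<longrightarrow> alpha_limit_set p q c z = julia_set p q c)}"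
  have "c0 \<in> interior G" if cr: "critical_orbits_return p q c0" for c0
  proof -
    obtain \<delta> R A r where \<delta>: "\<delta> > 0" and tr: "\<And>c. c \<in> ball c0 \<delta> \<Longrightarrow> trap p q c R A r"
      using trap_exists_near[OF assms cr] by blast
    have "c \<in> G" if "c \<in> ball c0 \<delta>" for c
    proof -
      interpret trap p q c R A r by (rule tr[OF that])
      have "alpha_limit_set p q c z = julia_set p q c" if "z \<notin> postcritical_set p q c" for z
        unfolding julia_set_eq by (rule alpha_limit_set_eq[OF that])
      then show "c \<in> G" using hyperbolic unfolding G_def by blast
    qed
    then have "ball c0 \<delta> \<subseteq> G" by blast
    then show ?thesis using \<delta> by (intro interiorI[OF open_ball]) auto
  qed
  moreover have "critical_orbits_return p q c" if "c \<notin> mandelbrot_set p q" for c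
    using that unfolding critical_orbits_return_def mandelbrot_set_def filled_julia_set_def by blast
  moreover have "critical_orbits_return p q c" if sc: "simple_centre p q c" for c
    unfolding critical_orbits_return_def
  proof (intro allI impI)
    fix x assume x: "forward_orbit (corr p q c) x" "x 0 = 0" "bounded (range x)"
    then obtain n where "is_cycle p q c n x" using sc unfolding simple_centre_def by blast
    then have "n > 0" "x (0 + n) = x 0" unfolding is_cycle_def by blast+
    then show "\<exists>i\<ge>1. x i = 0" using x(2) by (intro exI[of _ n]) simp
  qed
  ultimately have "UNIV - mandelbrot_set p q \<subseteq> interior G" "{c. simple_centre p q c} \<subseteq> interior G"
    by auto
  moreover have "c \<in> G" if "c \<in> interior G" for c using that interior_subset by blast
  then have "\<forall>c\<in>interior G. hyperbolic p q c"
    "\<forall>c\<in>interior G. \<forall>z. z \<notin> postcritical_set p q c \<longrightarrow>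
                    alpha_limit_set p q c z = julia_set p q c"
    unfolding G_def by blast+
  ultimately show ?thesis using open_interior by blast
qed

end
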